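(* Suppose that $f$ is the spectral density of a deterministic process such that the sequence $\{\sigma_n(f)\}$ is weakly varying, that is, $\lim_{n\to\infty}\sigma_{n+1}(f)/\sigma_n(f)=1$. Let $g$ be a function of the form $$g(\lambda)=h(\lambda)\cdot\frac{t_1(\lambda)}{t_2(\lambda)},$$ where $h\in B_+^-$ and $t_1,t_2$ are nonnegative trigonometric polynomials, not identically zero, such that $fg\in B$. Then $g$ is the spectral density of a nondeterministic process, and $$\lim_{n\to\infty}\frac{\sigma_n^2(fg)}{\sigma_n^2(f)}=G(g)>0,$$ where $G(g)$ is the geometric mean of $g$.
   Context: Processes are discrete-time second-order stationary processes $X(t)$, $t\in\mathbb Z$, possessing a spectral density, i.e. a nonnegative function $f\in L^1([-\pi,\pi])$. The process is deterministic if $\int_{-\pi}^{\pi}\ln f(\lambda)\,d\lambda=-\infty$ and nondeterministic if $\int_{-\pi}^{\pi}\ln f(\lambda)\,d\lambda>-\infty$ (Szegő condition). $\sigma_n^2(f)$ is the best linear one-step ahead mean-squared prediction error of $X(0)$ based on $X(-n),\dots,X(-1)$; equivalently $$\sigma_n^2(f)=\min_{q_n\in\mathcal Q_n}\int_{-\pi}^{\pi}|q_n(e^{i\lambda})|^2 f(\lambda)\,d\lambda,$$ where $\mathcal Q_n$ is the set of monic polynomials of degree $n$, and $\sigma_n(f)\ge0$. A sequence of non-zero numbers $\{a_n\}$ is weakly varying if $a_{n+1}/a_n\to1$. The geometric mean of a nonnegative function $g$ is $G(g)=\exp\left\{\frac1{2\pi}\int_{-\pi}^{\pi}\ln g(\lambda)\,d\lambda\right\}$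 if $\ln g\in L^1([-\pi,\pi])$, and $G(g)=0$ otherwise. $B$ is the set of all nonnegative functions that are Riemann integrable on $[-\pi,\pi]$; $B_+^-$ is the set of $h\in B$ for which there are constants $0<m\le M<\infty$ with $m\le h(\lambda)\le M$ for all $\lambda$. A trigonometric polynomial is a function $t(\lambda)=a_0+\sum_{k=1}^{\nu}(a_k\cos k\lambda+b_k\sin k\lambda)$ with real coefficients. At the finitely many zeros of $t_2$ the functions $g$ and $fg$ may be assigned arbitrary nonnegative values.
   Formalization: That g is a spectral density is asserted only when g is in L^1 (it can fail: h=t_1=1, t_2=1-cos x, f=exp(-1/x^2)); nonnegativity, measurability, the Szegő condition for g, the limit and G(g)>0 are proved without this restriction. *)

theory Defs
  imports "HOL-Analysis.Analysis" "HOL-Computational_Algebra.Polynomial"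
begin

text \<open>
  Densities are functions of type real to real of which only the values on \<open>{-pi..pi}\<close> matter.
  Integrals are taken over the completed Lebesgue measure, since Riemann integrable
  functions need not be Borel measurable.
\<close>

definition spectral_density :: "(real \<Rightarrow> real) \<Rightarrow> bool" where
  "spectral_density f \<longleftrightarrow>
     (\<forall>x\<in>{-pi..pi}. 0 \<le> f x) \<and> set_integrable lebesgue {-pi..pi} f"

text \<open>
  The library has \<open>ln 0 = 0\<close> on the reals, so the convention \<open>ln 0 = -\<infinity>\<close> has to be
  built in by hand.
\<close>

definition ext_ln :: "real \<Rightarrow> ereal" where
  "ext_ln y = (if 0 < y then ereal (ln y) else -\<infinity>)"

text \<open>
  The integral of \<open>ln f\<close> as an extended real: positive part minus negative part, where
  \<open>e2ennreal\<close> truncates negative arguments to 0. For integrable \<open>f\<close> the first term is finite,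
  because \<open>ln y \<le> y\<close>. (If both terms are infinite, \<open>\<infinity> - \<infinity> = \<infinity>\<close> in type \<open>ereal\<close>.)
\<close>

definition log_integral :: "(real \<Rightarrow> real) \<Rightarrow> ereal" where
  "log_integral f =
     enn2ereal (\<integral>\<^sup>+x\<in>{-pi..pi}. e2ennreal (ext_ln (f x)) \<partial>lebesgue)
   - enn2ereal (\<integral>\<^sup>+x\<in>{-pi..pi}. e2ennreal (- ext_ln (f x)) \<partial>lebesgue)"

definition deterministic :: "(real \<Rightarrow> real) \<Rightarrow> bool" where
  "deterministic f \<longleftrightarrow> log_integral f = -\<infinity>"

definition nondeterministic :: "(real \<Rightarrow> real) \<Rightarrow> bool" where
  "nondeterministic f \<longleftrightarrow> log_integral f > -\<infinity>"

text \<open>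
  The infimum is attained (it is the squared distance from a vector to a
  finite-dimensional subspace of a weighted \<open>L\<^sup>2\<close> space), so it is a minimum.
\<close>

definition pred_err_sq :: "nat \<Rightarrow> (real \<Rightarrow> real) \<Rightarrow> real" where
  "pred_err_sq n f =
     (INF q\<in>{q :: complex poly. degree q = n \<and> lead_coeff q = 1}.
        (LINT x:{-pi..pi}|lebesgue. (cmod (poly q (exp (\<i> * complex_of_real x))))\<^sup>2 * f x))"

definition pred_err :: "nat \<Rightarrow> (real \<Rightarrow> real) \<Rightarrow> real" where
  "pred_err n f = sqrt (pred_err_sq n f)"

definition weakly_varying :: "(nat \<Rightarrow> real) \<Rightarrow> bool" where
  "weakly_varying a \<longleftrightarrow> (\<forall>n. a n \<noteq> 0) \<and> (\<lambda>n. a (Suc n) / a n) \<longlonglongrightarrow> 1"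

text \<open>
  \<open>ln g \<in> L\<^sup>1\<close> includes that \<open>ln g\<close> is finite almost everywhere; because of \<open>ln 0 = 0\<close>
  this is not implied by integrability of \<open>\<lambda>x. ln (g x)\<close>.
\<close>

definition geom_mean :: "(real \<Rightarrow> real) \<Rightarrow> real" where
  "geom_mean g =
     (if (AE x in lebesgue. x \<in> {-pi..pi} \<longrightarrow> 0 < g x) \<and>
         set_integrable lebesgue {-pi..pi} (\<lambda>x. ln (g x))
      then exp (1 / (2 * pi) * (LINT x:{-pi..pi}|lebesgue. ln (g x)))
      else 0)"

text \<open>
  The Riemann integral as the limit of Riemann sums as the mesh tends to 0; in
  dimension one, \<open>measure lborel K\<close> is the length of the interval \<open>K\<close>. The library's
  \<open>has_integral\<close> is the more general gauge integral.
\<close>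

definition riemann_integrable_on :: "(real \<Rightarrow> real) \<Rightarrow> real \<Rightarrow> real \<Rightarrow> bool" where
  "riemann_integrable_on f a b \<longleftrightarrow>
     (\<exists>I. \<forall>\<epsilon>>0. \<exists>\<delta>>0. \<forall>p. p tagged_division_of {a..b} \<and> (\<forall>(x, K)\<in>p. measure lborel K < \<delta>) \<longrightarrow>
        \<bar>(\<Sum>(x, K)\<in>p. measure lborel K * f x) - I\<bar> < \<epsilon>)"

definition class_B :: "(real \<Rightarrow> real) set" where
  "class_B = {f. (\<forall>x\<in>{-pi..pi}. 0 \<le> f x) \<and> riemann_integrable_on f (-pi) pi}"

definition class_B_bdd :: "(real \<Rightarrow> real) set" where
  "class_B_bdd =
     {h \<in> class_B. \<exists>m M. 0 < m \<and> m \<le> M \<and> (\<forall>x\<in>{-pi..pi}. m \<le> h x \<and> h x \<le> M)}"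

definition trig_poly :: "(real \<Rightarrow> real) \<Rightarrow> bool" where
  "trig_poly t \<longleftrightarrow>
     (\<exists>(N::nat) (a::nat \<Rightarrow> real) (b::nat \<Rightarrow> real). \<forall>x.
        t x = a 0 + (\<Sum>k=1..N. a k * cos (real k * x) + b k * sin (real k * x)))"

end

theory Submission
  imports Defs "HOL-Complex_Analysis.Cauchy_Integral_Formula"
    "HOL-Computational_Algebra.Fundamental_Theorem_Algebra" "HOL-Real_Asymp.Real_Asymp"
begin

text \<open>
  Let \<open>p\<close> be a polynomial of degree \<open>d\<close>. Reflecting its roots into the closed unit disc gives
  \<open>|p| = c |s|\<close> on the unit circle with \<open>s\<close> monic, where \<open>c\<^sup>2 = G(|p|\<^sup>2)\<close> by Jensen's formula.
  If \<open>|p|\<^sup>2 F \<le> F'\<close>, multiplying competitors by \<open>s\<close> therefore yields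
  \<open>G(|p|\<^sup>2) \<sigma>\<^sub>n\<^sub>+\<^sub>d\<^sup>2(F) \<le> \<sigma>\<^sub>n\<^sup>2(F')\<close>.
  With \<open>F = f\<close>, \<open>F' = f g\<close> and \<open>|p|\<^sup>2 \<le> g\<close> this bounds the ratio of the prediction errors from
  below; with \<open>F = f g\<close>, \<open>F' = f\<close> and \<open>|p|\<^sup>2 \<le> 1 / g\<close> it bounds it from above, the shift by \<open>d\<close>
  being harmless because \<open>\<sigma>\<^sub>n(f)\<close> is weakly varying.
  It remains to choose \<open>p\<close> so that \<open>G(|p|\<^sup>2)\<close> is close to \<open>G(g)\<close>, respectively \<open>1 / G(g)\<close>. Since
  \<open>t\<^sub>i = |P\<^sub>i|\<close> on the circle for polynomials \<open>P\<^sub>i\<close>, one takes \<open>p = P\<^sub>1 r\<close> with \<open>|r|\<^sup>2\<close> just below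
  \<open>h / (t\<^sub>1 t\<^sub>2)\<close>, respectively \<open>p = P\<^sub>2 r\<close> with \<open>|r|\<^sup>2\<close> just below \<open>1 / (h t\<^sub>1 t\<^sub>2)\<close>; such \<open>r\<close> exist
  by the Weierstrass theorem, as the Riemann integrable \<open>h\<close> is an almost everywhere limit of
  continuous functions from below and from above.
\<close>

section \<open>Jensen's formula on the unit circle\<close>

text \<open>On the circle \<open>cmod (z - a)\<close> equals \<open>cmod (1 - cnj a * z)\<close>,
  and \<open>Ln (1 - cnj a * z)\<close> is holomorphic on a disc of radius greater than 1 and
  vanishes at 0. By the mean value property the integral of its real part is 0.\<close>

lemma has_integral_ln_cmod_inside:
  assumes "cmod a < 1"
  shows "((\<lambda>x. ln (cmod (cis x - a))) has_integral 0) {-pi..pi}"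
proof -
  define b where "b = cnj a"
  \<comment> \<open>The radius is \<open>1 / cmod b\<close>, or 2 when \<open>b = 0\<close>; in both
    cases it exceeds 1 and \<open>cmod (b * z) < 1\<close> on \<open>D\<close>.\<close>
  define D where "D = ball (0::complex) (1 / (if b = 0 then 1/2 else cmod b))"
  have b: "cmod b < 1" using assms by (simp add: b_def)
  have D: "1 - b * z \<notin> \<real>\<^sub>\<le>\<^sub>0" if "z \<in> D" for z
  proof -
    have "cmod (b * z) < 1"
      using that by (auto simp: D_def norm_mult field_simps split: if_splits)
    then have "Re (b * z) < 1" using complex_Re_le_cmod[of "b * z"] by linarith
    then show ?thesis by (auto simp: complex_nonpos_Reals_iff)
  qed
  define F where "F = (\<lambda>z. Ln (1 - b * z))"
  have 0: "(0::complex) \<in> interior D" by (auto simp: D_def interior_open)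
  have hF: "F holomorphic_on D" unfolding F_def using D by (intro holomorphic_intros) auto
  \<comment> \<open>Since \<open>F 0 = 0\<close>, this is \<open>F z / z\<close> with the removable
    singularity filled in; its contour integral is the integral of i times
    \<open>F (cis t)\<close>.\<close>
  define k where "k = (\<lambda>z. if z = 0 then deriv F 0 else (F z - F 0) / (z - 0))"
  have hk: "k holomorphic_on D" unfolding k_def by (rule pole_lemma[OF hF 0])
  have "(k has_contour_integral 0) (part_circlepath 0 1 (-pi) pi)"
  proof (rule Cauchy_theorem_convex_simple[OF hk])
    show "path_image (part_circlepath 0 1 (-pi) pi) \<subseteq> D"
    proof
      fix z assume "z \<in> path_image (part_circlepath 0 1 (-pi) pi)"
      then have "cmod z = 1"
        by (auto dest: in_path_image_part_circlepath)
      then show "z \<in> D" using b by (auto simp: D_def field_simps)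
    qed
    have "cis (-pi) = cis pi" by (simp add: cis.ctr)
    then show "pathfinish (part_circlepath 0 1 (-pi) pi) = pathstart (part_circlepath 0 1 (-pi) pi)"
      by (simp only: pathstart_part_circlepath pathfinish_part_circlepath flip: cis_conv_exp)
    show "convex D" by (simp add: D_def)
  qed simp
  then have "((\<lambda>t. k (cis t) * \<i> * cis t) has_integral 0) {-pi..pi}"
    by (subst (asm) has_contour_integral_part_circlepath_iff) auto
  moreover have "k (cis t) * \<i> * cis t = \<i> * F (cis t)" for t
    by (simp add: k_def F_def)
  ultimately have "((\<lambda>t. \<i> * F (cis t)) has_integral 0) {-pi..pi}" by simp
  then have "((\<lambda>t. Im (\<i> * F (cis t))) has_integral Im 0) {-pi..pi}"
    by (rule has_integral_linear[OF _ bounded_linear_Im, unfolded o_def])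
  moreover have "Im (\<i> * F (cis t)) = ln (cmod (cis t - a))" for t
  proof -
    have "cis t \<in> D" using b by (auto simp: D_def field_simps)
    then have "1 - b * cis t \<noteq> 0" using D by force
    moreover have "cmod (1 - b * cis t) = cmod (cis t - a)"
    proof -
      have "cmod (cis t - a) = cmod (cnj (cis t - a))" by (rule complex_mod_cnj[symmetric])
      also have "\<dots> = cmod (cis t) * cmod (cis (-t) - b)" by (simp add: b_def cis_cnj)
      also have "\<dots> = cmod (1 - b * cis t)"
        unfolding norm_mult[symmetric] by (simp add: algebra_simps cis_mult)
      finally show ?thesis by simp
    qed
    ultimately show ?thesis by (simp add: F_def Re_Ln)
  qed
  ultimately show ?thesis by simp
qed

lemma finite_cis_roots:
  assumes "p \<noteq> (0 :: complex poly)"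
  shows "finite {x \<in> {-pi..pi}. poly p (cis x) = 0}"
proof -
  have "inj_on cis {-pi<..pi}"
    by (rule inj_on_inverseI[of _ Arg]) (rule Arg_cis)
  moreover have "finite {z. poly p z = 0}" by (rule poly_roots_finite[OF assms])
  ultimately have "finite (cis -` {z. poly p z = 0} \<inter> {-pi<..pi})"
    by (rule finite_vimage_IntI[rotated])
  then have "finite (insert (-pi) (cis -` {z. poly p z = 0} \<inter> {-pi<..pi}))" by simp
  then show ?thesis by (rule rev_finite_subset) auto
qed

text \<open>
  For \<open>|a| = 1\<close> use monotone convergence: \<open>|z - r a| / (1 + r)\<close> decreases as \<open>r\<close> increases to 1.
\<close>

lemma has_integral_ln_cmod_circle:
  assumes a: "cmod a = 1"
  shows "((\<lambda>x. ln (cmod (cis x - a))) has_integral 0) {-pi..pi}"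
proof -
  define r where "r = (\<lambda>k::nat. 1 - 1 / (real k + 2))"
  have r: "0 < r k" "r k < 1" "r k \<le> r (Suc k)" for k
    by (auto simp: r_def field_simps)
  have rlim: "r \<longlonglongrightarrow> 1" unfolding r_def by real_asymp
  define f where "f = (\<lambda>k x. ln (cmod (cis x - of_real (r k) * a)) - ln (1 + r k))"
  \<comment> \<open>Where \<open>cis x = a\<close>, the functions \<open>f k\<close> tend to minus
    infinity, but \<open>ln 0 = 0\<close> makes the claimed limit finite. Such points are removed
    before monotone convergence.\<close>
  define S where "S = {-pi..pi} - {x \<in> {-pi..pi}. poly [:-a, 1:] (cis x) = 0}"
  have fin: "finite {x \<in> {-pi..pi}. poly [:-a, 1:] (cis x) = 0}"
    by (rule finite_cis_roots) simp
  have spike: "(u has_integral y) S \<longleftrightarrow> (u has_integral y) {-pi..pi}" for u :: "real \<Rightarrow> real" and y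
    unfolding S_def
    by (rule has_integral_spike_set_eq; rule negligible_finite, rule finite_subset[OF _ fin]) auto
  have int_f: "(f k has_integral - (2 * pi * ln (1 + r k))) S" for k
  proof -
    have "(f k has_integral 0 - (pi - (-pi)) *\<^sub>R ln (1 + r k)) {-pi..pi}"
      unfolding f_def
      using has_integral_const_real[of "ln (1 + r k)" "-pi" pi] r[of k] a
      by (intro has_integral_diff has_integral_ln_cmod_inside) (auto simp: norm_mult)
    then show ?thesis by (simp add: spike)
  qed
  have "(\<lambda>x. ln (cmod (cis x - a)) - ln 2) integrable_on S \<and>
        (\<lambda>k. integral S (f k)) \<longlonglongrightarrow> integral S (\<lambda>x. ln (cmod (cis x - a)) - ln 2)"
  proof (rule monotone_convergence_decreasing)
    show "f k integrable_on S" for k using int_f by blast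
    have nz: "cis x - of_real s * a \<noteq> 0" if "x \<in> S" "0 < s" "s \<le> 1" for x s
    proof
      assume "cis x - of_real s * a = 0"
      then have eq: "cis x = of_real s * a" by simp
      then have "cmod (cis x) = \<bar>s\<bar> * cmod a" by (metis norm_mult norm_of_real)
      then have "s = 1" using a that by simp
      then show False using eq that by (auto simp: S_def)
    qed
    show "f (Suc k) x \<le> f k x" if x: "x \<in> S" for k x
    proof -
      define c where "c = Re (cis x * cnj a)"
      have sq: "(cmod (cis x - of_real s * a))\<^sup>2 = 1 + s\<^sup>2 - 2 * s * c" for s
      proof -
        have "(cmod (cis x - of_real s * a))\<^sup>2
              = (cmod (cis x))\<^sup>2 + s\<^sup>2 * (cmod a)\<^sup>2 - 2 * s * c"
          unfolding c_def cmod_power2 by (simp add: power2_eq_square algebra_simps)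
        then show ?thesis using a by simp
      qed
      have "-1 \<le> c"
      proof -
        have "\<bar>c\<bar> \<le> cmod (cis x * cnj a)" unfolding c_def by (rule abs_Re_le_cmod)
        then show ?thesis using a by (simp add: norm_mult)
      qed
      define s where "s = r k"
      define t where "t = r (Suc k)"
      have st: "0 < s" "s \<le> t" "t < 1" using r[of k] r[of "Suc k"] by (auto simp: s_def t_def)
      \<comment> \<open>The cross-multiplied squares differ by a product whose factors are
        nonnegative because \<open>c\<close> is at least -1 and \<open>s\<close> and
        \<open>t\<close> satisfy \<open>0 < s \<le> t < 1\<close>.\<close>
      have "(1 + s\<^sup>2 - 2 * s * c) * (1 + t)\<^sup>2 - (1 + t\<^sup>2 - 2 * t * c) * (1 + s)\<^sup>2
            = 2 * (1 + c) * ((t - s) * (1 - s * t))"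
        by (simp add: power2_eq_square algebra_simps)
      moreover have "s * t \<le> 1" using st by (simp add: mult_le_one)
      ultimately have "(1 + t\<^sup>2 - 2 * t * c) * (1 + s)\<^sup>2 \<le> (1 + s\<^sup>2 - 2 * s * c) * (1 + t)\<^sup>2"
        using st \<open>-1 \<le> c\<close> by (smt (verit) mult_nonneg_nonneg)
      then have "(cmod (cis x - of_real t * a) * (1 + s))\<^sup>2 \<le> (cmod (cis x - of_real s * a) * (1 + t))\<^sup>2"
        by (simp add: sq power_mult_distrib)
      then have "cmod (cis x - of_real t * a) * (1 + s) \<le> cmod (cis x - of_real s * a) * (1 + t)"
        by (rule power2_le_imp_le) (use st in auto)
      then have "ln (cmod (cis x - of_real t * a) * (1 + s)) \<le> ln (cmod (cis x - of_real s * a) * (1 + t))"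
        using nz[OF x, of s] nz[OF x, of t] st by (subst ln_le_cancel_iff) auto
      then show ?thesis
        using nz[OF x, of s] nz[OF x, of t] st
        by (simp add: f_def s_def[symmetric] t_def[symmetric] ln_mult)
    qed
    show "(\<lambda>k. f k x) \<longlonglongrightarrow> ln (cmod (cis x - a)) - ln 2" if x: "x \<in> S" for x
    proof -
      have "(\<lambda>k. f k x) \<longlonglongrightarrow> ln (cmod (cis x - of_real 1 * a)) - ln (1 + 1)"
        unfolding f_def using nz[OF x, of 1] by (intro tendsto_intros rlim) auto
      then show ?thesis by simp
    qed
    have "\<bar>integral S (f k)\<bar> \<le> 2 * pi * ln 2" for k
      using r[of k] by (simp add: integral_unique[OF int_f] abs_mult)
    then show "bounded (range (\<lambda>k. integral S (f k)))"
      unfolding bounded_iff by auto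
  qed
  then have i: "(\<lambda>x. ln (cmod (cis x - a)) - ln 2) integrable_on S"
    and l: "(\<lambda>k. - (2 * pi * ln (1 + r k))) \<longlonglongrightarrow> integral S (\<lambda>x. ln (cmod (cis x - a)) - ln 2)"
    by (auto simp: integral_unique[OF int_f])
  have "(\<lambda>k. - (2 * pi * ln (1 + r k))) \<longlonglongrightarrow> - (2 * pi * ln (1 + 1))"
    by (intro tendsto_intros rlim) auto
  with l have "integral S (\<lambda>x. ln (cmod (cis x - a)) - ln 2) = - (2 * pi * ln 2)"
    using LIMSEQ_unique by fastforce
  with i have "((\<lambda>x. ln (cmod (cis x - a)) - ln 2) has_integral - (2 * pi * ln 2)) {-pi..pi}"
    by (metis spike integrable_integral)
  from has_integral_add[OF this has_integral_const_real[of "ln 2" "-pi" pi]]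
  show ?thesis by simp
qed

text \<open>Gauge integrability alone does not give absolute integrability. As
  \<open>cmod (cis x - a)\<close> is at most 2, \<open>ln 2 - ln (cmod (cis x - a))\<close> is
  nonnegative, and for nonnegative functions the two notions agree.\<close>

lemma
  assumes a: "cmod a \<le> 1"
  shows absolutely_integrable_ln_cmod: "(\<lambda>x. ln (cmod (cis x - a))) absolutely_integrable_on {-pi..pi}"
    and integral_ln_cmod: "integral {-pi..pi} (\<lambda>x. ln (cmod (cis x - a))) = 0"
proof -
  have hi: "((\<lambda>x. ln (cmod (cis x - a))) has_integral 0) {-pi..pi}"
    using has_integral_ln_cmod_inside[of a] has_integral_ln_cmod_circle[of a] a by fastforce
  then show "integral {-pi..pi} (\<lambda>x. ln (cmod (cis x - a))) = 0" by (rule integral_unique)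
  have ub: "ln (cmod (cis x - a)) \<le> ln 2" for x
  proof (cases "cis x = a")
    case False
    have "cmod (cis x - a) \<le> 2" using norm_triangle_ineq4[of "cis x" a] a by simp
    then show ?thesis using False by (subst ln_le_cancel_iff) auto
  qed simp
  have "(\<lambda>x. ln 2 - ln (cmod (cis x - a))) absolutely_integrable_on {-pi..pi}"
    by (rule nonnegative_absolutely_integrable_1)
       (use hi ub in \<open>auto intro!: integrable_diff\<close>)
  from set_integral_diff(1)[OF absolutely_integrable_on_const[of "{-pi..pi}" "ln 2"] this]
  show "(\<lambda>x. ln (cmod (cis x - a))) absolutely_integrable_on {-pi..pi}" by simp
qed

text \<open>A root \<open>a\<close> outside the closed disc is replaced by \<open>1 / cnj a\<close>.\<close>

lemma monic_reflection:
  assumes "p \<noteq> (0 :: complex poly)"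
  shows "\<exists>s c. 0 < c \<and> degree s = degree p \<and> lead_coeff s = 1 \<and>
    (\<forall>z. cmod z = 1 \<longrightarrow> cmod (poly p z) = c * cmod (poly s z)) \<and>
    (\<lambda>x. ln (cmod (poly p (cis x)))) absolutely_integrable_on {-pi..pi} \<and>
    integral {-pi..pi} (\<lambda>x. ln (cmod (poly p (cis x)))) = 2 * pi * ln c"
  using assms
proof (induction "degree p" arbitrary: p)
  case 0
  then obtain a where a: "p = [:a:]" "a \<noteq> 0" by (metis degree_0_id of_nat_0 pCons_0_0)
  show ?case
    by (rule exI[of _ 1], rule exI[of _ "cmod a"]) (use a in simp)
next
  case (Suc n)
  from Suc.hyps(2) have "\<not> constant (poly p)" by (simp add: constant_degree)
  then obtain a where "poly p a = 0" using fundamental_theorem_of_algebra by blast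
  then obtain q where q: "p = [:-a, 1:] * q" by (metis poly_eq_0_iff_dvd dvdE)
  with Suc.prems have "q \<noteq> 0" by auto
  with q Suc.hyps(2) have "n = degree q" by (simp add: degree_mult_eq del: mult_pCons_left)
  from Suc.hyps(1)[OF this \<open>q \<noteq> 0\<close>] obtain s c where
    c: "0 < c" and s: "degree s = degree q" "lead_coeff s = 1" and
    sc: "\<And>z. cmod z = 1 \<Longrightarrow> cmod (poly q z) = c * cmod (poly s z)" and
    ai: "(\<lambda>x. ln (cmod (poly q (cis x)))) absolutely_integrable_on {-pi..pi}" and
    iv: "integral {-pi..pi} (\<lambda>x. ln (cmod (poly q (cis x)))) = 2 * pi * ln c"
    by blast
  \<comment> \<open>The factor \<open>e\<close> is 1 when the root stays and \<open>cmod a\<close>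
    when it is reflected. Together with the modulus of the constant in the base case these factors
    multiply up to \<open>c\<close>.\<close>
  obtain b e where b: "cmod b \<le> 1" and e: "0 < e"
    and be: "\<And>z. cmod z = 1 \<Longrightarrow> cmod (z - a) = e * cmod (z - b)"
  proof (cases "cmod a \<le> 1")
    case True
    then show ?thesis using that[of a 1] by simp
  next
    case False
    then have a0: "a \<noteq> 0" by auto
    have "cmod (z - a) = cmod a * cmod (z - 1 / cnj a)" if z: "cmod z = 1" for z
    proof -
      have "z * cnj z = 1" using z by (simp add: complex_norm_square[symmetric])
      then have "cnj a * (z - 1 / cnj a) = - z * cnj (z - a)"
        using a0 by (simp add: field_simps)
      then have "cmod (cnj a * (z - 1 / cnj a)) = cmod (- z * cnj (z - a))"
        by (rule arg_cong)
      also have "\<dots> = cmod (z - a)"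
        using z by (simp only: norm_mult norm_minus_cancel complex_mod_cnj)
      finally show ?thesis using z by (simp add: norm_mult)
    qed
    then show ?thesis using that[of "1 / cnj a" "cmod a"] False a0
      by (auto simp: norm_divide field_simps)
  qed
  \<comment> \<open>At zeros of \<open>p\<close> the logarithm of the product need not split,
    because \<open>ln 0 = 0\<close>.\<close>
  define S where "S = {x \<in> {-pi..pi}. poly p (cis x) = 0}"
  have "finite S" unfolding S_def by (rule finite_cis_roots[OF Suc.prems])
  then have nS: "negligible S" by (rule negligible_finite)
  define w where "w = (\<lambda>x. ln e + ln (cmod (cis x - b)) + ln (cmod (poly q (cis x))))"
  have eq: "ln (cmod (poly p (cis x))) = w x" if "x \<in> {-pi..pi} - S" for x
  proof -
    have nz: "cis x - a \<noteq> 0" "poly q (cis x) \<noteq> 0" using that q by (auto simp: S_def)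
    have "cis x - b \<noteq> 0"
      using be[of "cis x"] nz(1) e by auto
    moreover have "cmod (poly p (cis x)) = cmod (cis x - a) * cmod (poly q (cis x))"
      unfolding q poly_mult norm_mult by simp
    with be[of "cis x"] have "cmod (poly p (cis x)) = e * cmod (cis x - b) * cmod (poly q (cis x))"
      by simp
    ultimately show ?thesis using nz e by (simp add: w_def ln_mult)
  qed
  have aw: "w absolutely_integrable_on {-pi..pi}"
    unfolding w_def
    by (intro set_integral_add(1) ai absolutely_integrable_ln_cmod[OF b] absolutely_integrable_on_const) simp
  have "((\<lambda>x. ln (cmod (poly q (cis x)))) has_integral 2 * pi * ln c) {-pi..pi}"
    using set_lebesgue_integral_eq_integral(1)[OF ai] iv by (metis integrable_integral)
  moreover have "((\<lambda>x. ln (cmod (cis x - b))) has_integral 0) {-pi..pi}"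
    using set_lebesgue_integral_eq_integral(1)[OF absolutely_integrable_ln_cmod[OF b]] integral_ln_cmod[OF b]
    by (metis integrable_integral)
  ultimately have "(w has_integral measure lborel {-pi..pi} *\<^sub>R ln e + 0 + 2 * pi * ln c) {-pi..pi}"
    unfolding w_def by (intro has_integral_add has_integral_const_real)
  then have "integral {-pi..pi} w = 2 * pi * ln e + 2 * pi * ln c"
    by (simp add: integral_unique)
  also have "\<dots> = 2 * pi * ln (e * c)" using e c by (simp add: ln_mult algebra_simps)
  finally have iw: "integral {-pi..pi} w = 2 * pi * ln (e * c)" .
  show ?case
  proof (intro exI conjI allI impI)
    show "0 < e * c" using e c by simp
    have "s \<noteq> 0" using s by auto
    then show "degree ([:-b, 1:] * s) = degree p"
      using \<open>n = degree q\<close> s Suc.hyps(2) by (subst degree_mult_eq) auto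
    show "lead_coeff ([:-b, 1:] * s) = 1" using s by (simp add: lead_coeff_mult del: mult_pCons_left)
    show "cmod (poly p z) = e * c * cmod (poly ([:-b, 1:] * s) z)" if "cmod z = 1" for z
      using be[OF that] sc[OF that] unfolding q poly_mult norm_mult by simp
    show "(\<lambda>x. ln (cmod (poly p (cis x)))) absolutely_integrable_on {-pi..pi}"
      by (rule absolutely_integrable_spike[OF aw nS eq])
    show "integral {-pi..pi} (\<lambda>x. ln (cmod (poly p (cis x)))) = 2 * pi * ln (e * c)"
      unfolding iw[symmetric] by (rule integral_spike[OF nS]) (simp add: eq)
  qed
qed

corollary absolutely_integrable_ln_cmod_poly:
  "p \<noteq> (0 :: complex poly) \<Longrightarrow> (\<lambda>x. ln (cmod (poly p (cis x)))) absolutely_integrable_on {-pi..pi}"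
  using monic_reflection by blast

lemma AE_circle_poly_nonzero:
  assumes "q \<noteq> (0 :: complex poly)"
  shows "AE x \<in> {-pi..pi} in lebesgue. poly q (cis x) \<noteq> 0"
proof -
  have "negligible {x \<in> {-pi..pi}. poly q (cis x) = 0}"
    by (rule negligible_finite[OF finite_cis_roots[OF assms]])
  then show ?thesis
    by (intro AE_I'[of "{x \<in> {-pi..pi}. poly q (cis x) = 0}"]) (auto simp: negligible_iff_null_sets)
qed

lemma integral_ln_cmod_poly_mult:
  assumes "p \<noteq> 0" "q \<noteq> (0 :: complex poly)"
  shows "integral {-pi..pi} (\<lambda>x. ln (cmod (poly (p * q) (cis x)))) =
    integral {-pi..pi} (\<lambda>x. ln (cmod (poly p (cis x)))) + integral {-pi..pi} (\<lambda>x. ln (cmod (poly q (cis x))))"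
proof -
  have "negligible {x \<in> {-pi..pi}. poly (p * q) (cis x) = 0}"
    using assms by (intro negligible_finite finite_cis_roots) simp
  then have "integral {-pi..pi} (\<lambda>x. ln (cmod (poly (p * q) (cis x)))) =
      integral {-pi..pi} (\<lambda>x. ln (cmod (poly p (cis x))) + ln (cmod (poly q (cis x))))"
    by (rule integral_spike) (auto simp: norm_mult ln_mult)
  also have "\<dots> = integral {-pi..pi} (\<lambda>x. ln (cmod (poly p (cis x)))) + integral {-pi..pi} (\<lambda>x. ln (cmod (poly q (cis x))))"
    using absolutely_integrable_ln_cmod_poly[OF assms(1)] absolutely_integrable_ln_cmod_poly[OF assms(2)]
    by (intro integral_add set_lebesgue_integral_eq_integral(1))
  finally show ?thesis .
qed

section \<open>Prediction errors\<close>

lemma pred_err_sq_nonneg: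
  assumes "\<And>x. x \<in> {-pi..pi} \<Longrightarrow> 0 \<le> F x"
  shows "0 \<le> pred_err_sq n F"
  unfolding pred_err_sq_def
proof (rule cINF_greatest)
  show "{q :: complex poly. degree q = n \<and> lead_coeff q = 1} \<noteq> {}"
    by (auto intro!: exI[of _ "monom 1 n"] simp: degree_monom_eq)
qed (use assms in \<open>auto simp: set_lebesgue_integral_def indicator_def intro!: integral_nonneg_AE\<close>)

lemma set_integrable_cmod_poly_mult:
  assumes "set_integrable lebesgue {-pi..pi} F"
  shows "set_integrable lebesgue {-pi..pi} (\<lambda>x. (cmod (poly q (cis x)))\<^sup>2 * F x)"
proof (rule absolutely_integrable_bounded_measurable_product_real[OF _ _ _ assms])
  have c: "continuous_on UNIV (\<lambda>x. (cmod (poly q (cis x)))\<^sup>2)"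
    by (intro continuous_intros)
  show "(\<lambda>x. (cmod (poly q (cis x)))\<^sup>2) \<in> borel_measurable (lebesgue_on {-pi..pi})"
    by (intro continuous_imp_measurable_on_sets_lebesgue continuous_on_subset[OF c]) auto
  show "bounded ((\<lambda>x. (cmod (poly q (cis x)))\<^sup>2) ` {-pi..pi})"
    by (intro compact_imp_bounded compact_continuous_image continuous_on_subset[OF c]) auto
qed simp

text \<open>Each competitor \<open>q\<close> for \<open>F'\<close> yields the competitor
  \<open>q * s\<close> for \<open>F\<close>, monic of degree \<open>n + degree p\<close>, at no more
  than \<open>1 / c^2\<close> times the cost. The exponential is \<open>c^2\<close>, by Jensen's
  formula.\<close>

lemma pred_err_sq_ge_mult:
  assumes p: "p \<noteq> 0"
    and F: "set_integrable lebesgue {-pi..pi} F" "\<And>x. x \<in> {-pi..pi} \<Longrightarrow> 0 \<le> F x"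
    and F': "set_integrable lebesgue {-pi..pi} F'"
    and le: "AE x \<in> {-pi..pi} in lebesgue. (cmod (poly p (cis x)))\<^sup>2 * F x \<le> F' x"
  shows "exp (integral {-pi..pi} (\<lambda>x. ln (cmod (poly p (cis x)))) / pi) * pred_err_sq (n + degree p) F
    \<le> pred_err_sq n F'"
proof -
  obtain s c where c: "0 < c" and s: "degree s = degree p" "lead_coeff s = 1" and
    sc: "\<And>z. cmod z = 1 \<Longrightarrow> cmod (poly p z) = c * cmod (poly s z)" and
    iv: "integral {-pi..pi} (\<lambda>x. ln (cmod (poly p (cis x)))) = 2 * pi * ln c"
    using monic_reflection[OF p] by blast
  have "exp (integral {-pi..pi} (\<lambda>x. ln (cmod (poly p (cis x)))) / pi) = c\<^sup>2"
    using c by (simp add: iv exp_double)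
  moreover have "c\<^sup>2 * pred_err_sq (n + degree p) F \<le> pred_err_sq n F'"
    unfolding pred_err_sq_def[of n]
  proof (rule cINF_greatest)
    show "{q :: complex poly. degree q = n \<and> lead_coeff q = 1} \<noteq> {}"
      by (auto intro!: exI[of _ "monom 1 n"] simp: degree_monom_eq)
    fix q :: "complex poly" assume "q \<in> {q. degree q = n \<and> lead_coeff q = 1}"
    then have q: "degree q = n" "lead_coeff q = 1" by auto
    let ?I = "\<lambda>q F. LINT x:{-pi..pi}|lebesgue. (cmod (poly q (cis x)))\<^sup>2 * F x"
    have "pred_err_sq (n + degree p) F \<le> ?I (q * s) F"
      unfolding pred_err_sq_def cis_conv_exp[symmetric]
    proof (rule cINF_lower)
      have "q \<noteq> 0" "s \<noteq> 0" using q s by auto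
      then show "q * s \<in> {q. degree q = n + degree p \<and> lead_coeff q = 1}"
        using q s lead_coeff_mult[of q s] by (simp add: degree_mult_eq)
      show "bdd_below ((\<lambda>q. ?I q F) ` {q. degree q = n + degree p \<and> lead_coeff q = 1})"
        by (rule bdd_belowI2[of _ 0]) (use F in \<open>auto simp: set_lebesgue_integral_def indicator_def intro!: integral_nonneg_AE\<close>)
    qed
    then have "c\<^sup>2 * pred_err_sq (n + degree p) F \<le> c\<^sup>2 * ?I (q * s) F"
      by (intro mult_left_mono) auto
    also have "\<dots> = (LINT x:{-pi..pi}|lebesgue. (cmod (poly q (cis x)))\<^sup>2 * ((cmod (poly p (cis x)))\<^sup>2 * F x))"
      by (subst set_integral_mult_right[symmetric], rule set_lebesgue_integral_cong)
         (auto simp: norm_mult power_mult_distrib sc)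
    also have "\<dots> \<le> ?I q F'"
    proof (rule set_integral_mono_AE)
      show "AE x \<in> {-pi..pi} in lebesgue.
          (cmod (poly q (cis x)))\<^sup>2 * ((cmod (poly p (cis x)))\<^sup>2 * F x) \<le> (cmod (poly q (cis x)))\<^sup>2 * F' x"
        using le by eventually_elim (auto intro: mult_left_mono)
    qed (intro set_integrable_cmod_poly_mult F F')+
    finally show "c\<^sup>2 * pred_err_sq (n + degree p) F
      \<le> (LINT x:{-pi..pi}|lebesgue. (cmod (poly q (exp (\<i> * complex_of_real x))))\<^sup>2 * F' x)"
      unfolding cis_conv_exp[symmetric] .
  qed
  ultimately show ?thesis by simp
qed

section \<open>Riemann integrable functions\<close>

text \<open>\<open>K\<close> lies in an open ball of diameter \<delta>. Thus a constant gauge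
  enforces the mesh condition of \<open>riemann_integrable_on\<close>.\<close>

lemma fine_ball_content_less:
  assumes "p tagged_division_of {a..b::real}" "(\<lambda>x. ball x (\<delta> / 2)) fine p" "(x, K) \<in> p"
  shows "measure lborel K < \<delta>"
proof -
  have sub: "K \<subseteq> ball x (\<delta> / 2)" using assms(2,3) by (auto simp: fine_def)
  obtain u v where K: "K = {u..v}" using tagged_division_ofD(4)[OF assms(1,3)] by (metis box_real(2))
  have "x \<in> K" by (rule tagged_division_ofD(2)[OF assms(1,3)])
  with K have "u \<in> K" "v \<in> K" "u \<le> v" by auto
  with sub have "dist x u < \<delta> / 2" "dist x v < \<delta> / 2" by auto
  then show ?thesis using K \<open>u \<le> v\<close> by (simp add: dist_real_def abs_if split: if_splits)
qed

lemma riemann_integrable_imp_integrable_on: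
  assumes "riemann_integrable_on f a b"
  shows "f integrable_on {a..b}"
proof -
  obtain I where I: "\<And>\<epsilon>. \<epsilon> > 0 \<Longrightarrow> \<exists>\<delta>>0. \<forall>p. p tagged_division_of {a..b} \<and> (\<forall>(x, K)\<in>p. measure lborel K < \<delta>) \<longrightarrow>
        \<bar>(\<Sum>(x, K)\<in>p. measure lborel K * f x) - I\<bar> < \<epsilon>"
    using assms unfolding riemann_integrable_on_def by blast
  have "(f has_integral I) {a..b}"
    unfolding has_integral_real
  proof (intro allI impI)
    fix e :: real assume "e > 0"
    then obtain \<delta> where \<delta>: "\<delta> > 0" "\<And>p. p tagged_division_of {a..b} \<Longrightarrow> (\<forall>(x, K)\<in>p. measure lborel K < \<delta>) \<Longrightarrow>
        \<bar>(\<Sum>(x, K)\<in>p. measure lborel K * f x) - I\<bar> < e"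
      using I[of e] by blast
    show "\<exists>\<gamma>. gauge \<gamma> \<and> (\<forall>\<D>. \<D> tagged_division_of {a..b} \<and> \<gamma> fine \<D> \<longrightarrow>
            norm ((\<Sum>(x, k)\<in>\<D>. measure lborel k *\<^sub>R f x) - I) < e)"
    proof (intro exI[of _ "\<lambda>x. ball x (\<delta> / 2)"] conjI allI impI)
      show "gauge (\<lambda>x. ball x (\<delta> / 2))" using \<delta> by (auto simp: gauge_def)
      fix p assume p: "p tagged_division_of {a..b} \<and> (\<lambda>x. ball x (\<delta> / 2)) fine p"
      then have "measure lborel K < \<delta>" if "(x, K) \<in> p" for x K
        using fine_ball_content_less that by blast
      then show "norm ((\<Sum>(x, k)\<in>p. measure lborel k *\<^sub>R f x) - I) < e"
        using \<delta>(2)[of p] p by auto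
    qed
  qed
  then show ?thesis by blast
qed

text \<open>Lower approximations of \<open>- h\<close> will serve as approximations of
  \<open>h\<close> from above.\<close>

lemma riemann_integrable_on_uminus:
  assumes "riemann_integrable_on f a b"
  shows "riemann_integrable_on (\<lambda>x. - f x) a b"
proof -
  obtain I where I: "\<And>\<epsilon>. \<epsilon> > 0 \<Longrightarrow> \<exists>\<delta>>0. \<forall>p. p tagged_division_of {a..b} \<and> (\<forall>(x, K)\<in>p. measure lborel K < \<delta>) \<longrightarrow>
        \<bar>(\<Sum>(x, K)\<in>p. measure lborel K * f x) - I\<bar> < \<epsilon>"
    using assms unfolding riemann_integrable_on_def by blast
  have eq: "\<bar>(\<Sum>(x, K)\<in>p. measure lborel K * - f x) - (- I)\<bar> = \<bar>(\<Sum>(x, K)\<in>p. measure lborel K * f x) - I\<bar>" for p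
  proof -
    have "(\<Sum>(x, K)\<in>p. measure lborel K * - f x) = - (\<Sum>(x, K)\<in>p. measure lborel K * f x)"
      unfolding sum_negf[symmetric] by (rule sum.cong) auto
    then show ?thesis by linarith
  qed
  show ?thesis
    unfolding riemann_integrable_on_def
    by (rule exI[of _ "- I"], intro allI impI, simp only: eq, rule I)
qed

text \<open>Darboux's criterion: over one fine division, take tags that nearly attain the suprema
  and tags that nearly attain the infima. Both Riemann sums are within \<open>e / 4\<close> of the
  same number.\<close>

lemma riemann_integrable_oscillation:
  assumes h: "riemann_integrable_on h a b" and ab: "a < b"
    and bnd: "\<And>x. x \<in> {a..b} \<Longrightarrow> m \<le> h x \<and> h x \<le> M" and e: "e > (0::real)"
  obtains D where "D division_of {a..b}" "(\<Sum>K\<in>D. measure lborel K * (Sup (h ` K) - Inf (h ` K))) \<le> e"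
proof -
  obtain I where I: "\<And>\<epsilon>. \<epsilon> > 0 \<Longrightarrow> \<exists>\<delta>>0. \<forall>p. p tagged_division_of {a..b} \<and> (\<forall>(x, K)\<in>p. measure lborel K < \<delta>) \<longrightarrow>
        \<bar>(\<Sum>(x, K)\<in>p. measure lborel K * h x) - I\<bar> < \<epsilon>"
    using h unfolding riemann_integrable_on_def by blast
  obtain \<delta> where \<delta>: "\<delta> > 0" "\<And>p. p tagged_division_of {a..b} \<Longrightarrow> (\<forall>(x, K)\<in>p. measure lborel K < \<delta>) \<Longrightarrow>
        \<bar>(\<Sum>(x, K)\<in>p. measure lborel K * h x) - I\<bar> < e / 4"
    using I[of "e / 4"] e by auto
  have "gauge (\<lambda>x::real. ball x (\<delta> / 2))" using \<delta> by (auto simp: gauge_def)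
  then obtain p where p: "p tagged_division_of {a..b}" and fine: "(\<lambda>x. ball x (\<delta> / 2)) fine p"
    using fine_division_exists_real by blast
  define D where "D = snd ` p"
  have D: "D division_of {a..b}" unfolding D_def by (rule division_of_tagged_division[OF p])
  have small: "measure lborel K < \<delta>" if "K \<in> D" for K
  proof -
    from that obtain x where "(x, K) \<in> p" by (auto simp: D_def)
    with p fine show ?thesis by (rule fine_ball_content_less)
  qed
  \<comment> \<open>The mesh condition involves only the intervals of \<open>D\<close>, so the
    original tags may be replaced by any others.\<close>
  have retag: "\<bar>(\<Sum>K\<in>D. measure lborel K * h (s K)) - I\<bar> < e / 4" if s: "\<And>K. K \<in> D \<Longrightarrow> s K \<in> K" for s
  proof -
    have inj: "inj_on (\<lambda>K. (s K, K)) D" by (auto intro: inj_onI)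
    have "(\<lambda>K. (s K, K)) ` D tagged_division_of {a..b}"
    proof (rule tagged_division_ofI)
      show "interior K1 \<inter> interior K2 = {}"
        if "(x1, K1) \<in> (\<lambda>K. (s K, K)) ` D" "(x2, K2) \<in> (\<lambda>K. (s K, K)) ` D" "(x1, K1) \<noteq> (x2, K2)" for x1 K1 x2 K2
        using that division_ofD(5)[OF D] by blast
      have "\<Union>{K. \<exists>x. (x, K) \<in> (\<lambda>K. (s K, K)) ` D} = \<Union> D" by blast
      then show "\<Union>{K. \<exists>x. (x, K) \<in> (\<lambda>K. (s K, K)) ` D} = {a..b}" using division_ofD(6)[OF D] by simp
    qed (use s division_ofD(1,2,4)[OF D] in blast)+
    moreover have "\<forall>(x, K)\<in>(\<lambda>K. (s K, K)) ` D. measure lborel K < \<delta>" using small by auto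
    ultimately have "\<bar>(\<Sum>(x, K)\<in>(\<lambda>K. (s K, K)) ` D. measure lborel K * h x) - I\<bar> < e / 4"
      by (rule \<delta>(2))
    then show ?thesis by (simp add: sum.reindex[OF inj])
  qed
  \<comment> \<open>The two taggings miss the extremal values by at most \<eta> each, which costs
    \<open>2 * \<eta> * (b - a) = e / 2\<close>; the other \<open>e / 2\<close> covers the two
    Riemann sums.\<close>
  define \<eta> where "\<eta> = e / (4 * (b - a))"
  have \<eta>: "\<eta> > 0" using e ab by (simp add: \<eta>_def)
  have ne: "h ` K \<noteq> {}" "bdd_above (h ` K)" "bdd_below (h ` K)" if "K \<in> D" for K
    using division_ofD(2,3)[OF D that] bnd
    by (auto intro!: bdd_aboveI2[of _ _ M] bdd_belowI2[of _ m])
  have "\<forall>K. \<exists>x. K \<in> D \<longrightarrow> x \<in> K \<and> Sup (h ` K) - \<eta> < h x"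
    using less_cSup_iff[OF ne(1,2)] \<eta>
    by (metis diff_less_eq imageE less_add_same_cancel1)
  then obtain s where s: "\<And>K. K \<in> D \<Longrightarrow> s K \<in> K \<and> Sup (h ` K) - \<eta> < h (s K)" by metis
  have "\<forall>K. \<exists>x. K \<in> D \<longrightarrow> x \<in> K \<and> h x < Inf (h ` K) + \<eta>"
    using cInf_less_iff[OF ne(1,3)] \<eta>
    by (metis imageE less_add_same_cancel1)
  then obtain t where t: "\<And>K. K \<in> D \<Longrightarrow> t K \<in> K \<and> h (t K) < Inf (h ` K) + \<eta>" by metis
  have "(\<Sum>K\<in>D. measure lborel K * (Sup (h ` K) - Inf (h ` K)))
      \<le> (\<Sum>K\<in>D. measure lborel K * h (s K) - measure lborel K * h (t K) + 2 * \<eta> * measure lborel K)"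
  proof (rule sum_mono)
    fix K assume K: "K \<in> D"
    have "measure lborel K * (Sup (h ` K) - Inf (h ` K)) \<le> measure lborel K * (h (s K) - h (t K) + 2 * \<eta>)"
      using s[OF K] t[OF K] by (intro mult_left_mono) auto
    then show "measure lborel K * (Sup (h ` K) - Inf (h ` K))
        \<le> measure lborel K * h (s K) - measure lborel K * h (t K) + 2 * \<eta> * measure lborel K"
      by (simp add: algebra_simps)
  qed
  also have "\<dots> = (\<Sum>K\<in>D. measure lborel K * h (s K)) - (\<Sum>K\<in>D. measure lborel K * h (t K))
      + 2 * \<eta> * (\<Sum>K\<in>D. measure lborel K)"
    by (simp add: sum.distrib sum_subtractf sum_distrib_left)
  also have "(\<Sum>K\<in>D. measure lborel K) = b - a"
    using additive_content_division[of D a b] D ab by simp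
  also have "2 * \<eta> * (b - a) = e / 2" using ab by (simp add: \<eta>_def field_simps)
  also have "(\<Sum>K\<in>D. measure lborel K * h (s K)) - (\<Sum>K\<in>D. measure lborel K * h (t K)) + e / 2 \<le> e"
  proof -
    have "\<bar>(\<Sum>K\<in>D. measure lborel K * h (s K)) - I\<bar> < e / 4" by (rule retag) (use s in blast)
    moreover have "\<bar>(\<Sum>K\<in>D. measure lborel K * h (t K)) - I\<bar> < e / 4" by (rule retag) (use t in blast)
    ultimately show ?thesis by linarith
  qed
  finally have "(\<Sum>K\<in>D. measure lborel K * (Sup (h ` K) - Inf (h ` K))) \<le> e" .
  with D show ?thesis by (rule that)
qed

text \<open>On \<open>{-pi..pi}\<close> the map \<open>cis\<close> identifies only the two
  endpoints, and \<open>x\<close> is neither of them.\<close>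

lemma cis_eq_imp_eq:
  assumes "x \<in> {-pi<..<pi}" "y \<in> {-pi..pi}" "cis x = cis y"
  shows "x = y"
proof (cases "y = -pi")
  case True
  then have "cis x = cis pi" using assms(3) by (simp add: cis.ctr)
  moreover have "Arg (cis x) = x" using assms(1) by (intro Arg_cis) auto
  ultimately have "x = pi" using Arg_cis[of pi] by simp
  then show ?thesis using assms(1) by simp
next
  case False
  then have "Arg (cis y) = y" using assms(2) by (intro Arg_cis) auto
  moreover have "Arg (cis x) = x" using assms(1) by (intro Arg_cis) auto
  ultimately show ?thesis using assms(3) by simp
qed

text \<open>
  The approximants are the inf-convolutions of \<open>h\<close> with \<open>n\<close> times the chordal distance, which makes
  them continuous on the circle even where \<open>h (-pi) \<noteq> h pi\<close>.
\<close>

lemma riemann_integrable_lower_approx: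
  fixes h :: "real \<Rightarrow> real"
  assumes h: "riemann_integrable_on h (-pi) pi"
    and bnd: "\<And>x. x \<in> {-pi..pi} \<Longrightarrow> m \<le> h x \<and> h x \<le> M"
  obtains \<phi> :: "nat \<Rightarrow> complex \<Rightarrow> real"
  where "\<And>n. continuous_on UNIV (\<phi> n)" "\<And>n z. m \<le> \<phi> n z"
    "\<And>n x. x \<in> {-pi..pi} \<Longrightarrow> \<phi> n (cis x) \<le> h x"
    "AE x \<in> {-pi..pi} in lebesgue. (\<lambda>n. \<phi> n (cis x)) \<longlonglongrightarrow> h x"
proof -
  define \<phi> where "\<phi> = (\<lambda>(n::nat) z. INF y\<in>{-pi..pi}. h y + real n * dist z (cis y))"
  have ne: "{-pi..pi} \<noteq> {}" by simp
  have bdd: "bdd_below ((\<lambda>y. h y + real n * dist z (cis y)) ` {-pi..pi})" for n z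
    by (rule bdd_belowI2[of _ m]) (use bnd in \<open>fastforce intro: add_increasing2\<close>)
  have le: "\<phi> n z \<le> h y + real n * dist z (cis y)" if "y \<in> {-pi..pi}" for n z y
    unfolding \<phi>_def by (rule cINF_lower[OF bdd that])
  have lower: "m \<le> \<phi> n z" for n z
    unfolding \<phi>_def by (rule cINF_greatest[OF ne]) (use bnd in \<open>fastforce intro: add_increasing2\<close>)
  have upper: "\<phi> n (cis x) \<le> h x" if "x \<in> {-pi..pi}" for n x
    using le[OF that, of n "cis x"] by simp
  have lip: "\<phi> n z \<le> \<phi> n w + real n * dist z w" for n z w
  proof -
    have "\<phi> n z - real n * dist z w \<le> \<phi> n w"
      unfolding \<phi>_def[THEN fun_cong, THEN fun_cong, of n w]
    proof (rule cINF_greatest[OF ne])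
      fix y assume y: "y \<in> {-pi..pi}"
      have "real n * dist z (cis y) \<le> real n * (dist z w + dist w (cis y))"
        by (intro mult_left_mono dist_triangle) auto
      with le[OF y, of n z] show "\<phi> n z - real n * dist z w \<le> h y + real n * dist w (cis y)"
        by (simp add: algebra_simps)
    qed
    then show ?thesis by simp
  qed
  have "(real n)-lipschitz_on UNIV (\<phi> n)" for n
  proof (rule lipschitz_onI)
    show "dist (\<phi> n z) (\<phi> n w) \<le> real n * dist z w" for z w
      using lip[of n z w] lip[of n w z] by (simp add: dist_real_def abs_le_iff dist_commute)
  qed simp
  then have cont: "continuous_on UNIV (\<phi> n)" for n by (rule lipschitz_on_continuous_on)
  have mono: "\<phi> n z \<le> \<phi> (Suc n) z" for n z
    unfolding \<phi>_def[THEN fun_cong, THEN fun_cong, of "Suc n" z]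
  proof (rule cINF_greatest[OF ne])
    fix y assume "y \<in> {-pi..pi}"
    then have "\<phi> n z \<le> h y + real n * dist z (cis y)" by (rule le)
    also have "\<dots> \<le> h y + real (Suc n) * dist z (cis y)" by (simp add: mult_right_mono)
    finally show "\<phi> n z \<le> h y + real (Suc n) * dist z (cis y)" .
  qed
  \<comment> \<open>This is the limit of the increasing approximants. It lies below
    \<open>h\<close>, and the aim is that \<open>h - g\<close> has integral 0.\<close>
  define g where "g = (\<lambda>x. SUP n. \<phi> n (cis x))"
  have lim: "(\<lambda>n. \<phi> n (cis x)) \<longlonglongrightarrow> g x" if "x \<in> {-pi..pi}" for x
    unfolding g_def
    by (rule LIMSEQ_incseq_SUP) (use upper[OF that] mono in \<open>auto intro!: bdd_aboveI2 incseq_SucI\<close>)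
  have gh: "g x \<le> h x" if "x \<in> {-pi..pi}" for x
    using LIMSEQ_le_const2[OF lim[OF that]] upper[OF that] by blast
  have ih: "h integrable_on {-pi..pi}" by (rule riemann_integrable_imp_integrable_on[OF h])
  have ig: "g integrable_on {-pi..pi}"
  proof (rule dominated_convergence(1)[where f = "\<lambda>n x. \<phi> n (cis x)" and h = "\<lambda>x. \<bar>m\<bar> + \<bar>M\<bar>"])
    show "(\<lambda>x. \<phi> n (cis x)) integrable_on {-pi..pi}" for n
      by (intro integrable_continuous_real continuous_on_compose2[OF cont[of n]] continuous_intros) auto
    show "norm (\<phi> n (cis x)) \<le> \<bar>m\<bar> + \<bar>M\<bar>" if "x \<in> {-pi..pi}" for n x
      using lower[of n "cis x"] upper[OF that, of n] bnd[OF that] by auto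
  qed (use lim in auto)
  define E where "E = (\<lambda>x. h x - g x)"
  have iE: "E integrable_on {-pi..pi}" unfolding E_def by (intro integrable_diff ih ig)
  have E0: "0 \<le> E x" if "x \<in> {-pi..pi}" for x using gh[OF that] by (simp add: E_def)
  \<comment> \<open>Points \<open>y\<close> outside \<open>interior K\<close> have chordal distance
    at least \<open>d > 0\<close> from \<open>cis x\<close>. Once \<open>n * d\<close> exceeds
    \<open>h x - m\<close>, such \<open>y\<close> contribute more than \<open>h x\<close>, hence
    more than the infimum; the other \<open>y\<close> satisfy the bound by \<open>h y\<close>
    alone.\<close>
  have ginf: "Inf (h ` K) \<le> g x" if x: "x \<in> interior K" and K: "K \<subseteq> {-pi..pi}" for x K
  proof -
    have x': "x \<in> {-pi<..<pi}" using x interior_mono[OF K] by auto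
    then have xI: "x \<in> {-pi..pi}" by auto
    have bK: "bdd_below (h ` K)" using K bnd by (intro bdd_belowI2[of _ m]) auto
    define d where "d = infdist (cis x) (cis ` ({-pi..pi} - interior K))"
    have "compact ({-pi..pi} - interior K)" by (intro compact_diff) auto
    then have cl: "closed (cis ` ({-pi..pi} - interior K))"
      by (intro compact_imp_closed compact_continuous_image continuous_intros)
    have nin: "cis x \<notin> cis ` ({-pi..pi} - interior K)"
      using cis_eq_imp_eq[OF x'] x by auto
    have dist: "d \<le> dist (cis x) (cis y)" if "y \<in> {-pi..pi} - interior K" for y
      unfolding d_def using that by (intro infdist_le) auto
    \<comment> \<open>This excludes the empty set, for which \<open>infdist\<close> is 0 by
      convention.\<close>
    have "pi \<in> {-pi..pi} - interior K" using interior_mono[OF K] by auto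
    then have "cis ` ({-pi..pi} - interior K) \<noteq> {}" by blast
    then have "d > 0"
      using infdist_pos_not_in_closed[OF cl _ nin] by (simp add: d_def)
    obtain n :: nat where n: "real n * d > h x - m"
      using reals_Archimedean3[OF \<open>d > 0\<close>] by blast
    have Inf_le: "Inf (h ` K) \<le> h x"
      using x interior_subset by (intro cInf_lower bK) auto
    have "Inf (h ` K) \<le> \<phi> n (cis x)"
      unfolding \<phi>_def
    proof (rule cINF_greatest[OF ne])
      fix y assume y: "y \<in> {-pi..pi}"
      show "Inf (h ` K) \<le> h y + real n * dist (cis x) (cis y)"
      proof (cases "y \<in> interior K")
        case True
        then have "Inf (h ` K) \<le> h y"
          using interior_subset by (intro cInf_lower bK) auto
        then show ?thesis by (simp add: add_increasing2)
      next
        case False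
        have "real n * d \<le> real n * dist (cis x) (cis y)"
          using dist[of y] y False by (intro mult_left_mono) auto
        then show ?thesis using n Inf_le bnd[OF y] by linarith
      qed
    qed
    also have "\<phi> n (cis x) \<le> g x"
      unfolding g_def by (rule cSUP_upper) (use upper[OF xI] in \<open>auto intro!: bdd_aboveI2\<close>)
    finally show ?thesis .
  qed
  \<comment> \<open>Inside each interval of a division \<open>ginf\<close> bounds \<open>E\<close>
    by the oscillation of \<open>h\<close>, and the weighted sum of the oscillations can be made
    arbitrarily small.\<close>
  have "integral {-pi..pi} E \<le> 0"
  proof (rule field_le_epsilon)
    fix e :: real assume "e > 0"
    obtain D where D: "D division_of {-pi..pi}"
      and De: "(\<Sum>K\<in>D. measure lborel K * (Sup (h ` K) - Inf (h ` K))) \<le> e"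
      using riemann_integrable_oscillation[OF h _ bnd \<open>e > 0\<close>] by auto
    have "integral {-pi..pi} E = (\<Sum>K\<in>D. integral K E)"
      by (rule integral_combine_division_topdown[OF iE D])
    also have "\<dots> \<le> (\<Sum>K\<in>D. measure lborel K * (Sup (h ` K) - Inf (h ` K)))"
    proof (rule sum_mono)
      fix K assume "K \<in> D"
      note KD = division_ofD(2-4)[OF D this]
      then obtain u v where K: "K = cbox u v" by blast
      define w where "w = Sup (h ` K) - Inf (h ` K)"
      have bK: "bdd_below (h ` K)" "bdd_above (h ` K)"
        using KD bnd by (auto intro!: bdd_belowI2[of _ m] bdd_aboveI2[of _ _ M])
      have "w \<ge> 0" unfolding w_def using cInf_le_cSup[of "h ` K"] bK KD by auto
      have iEK: "E integrable_on K" using KD K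
        by (metis box_real(2) iE integrable_on_subcbox)
      \<comment> \<open>\<open>ginf\<close> says nothing on the boundary of \<open>K\<close>, so
        \<open>E\<close> is replaced by 0 there, a change on a null set.\<close>
      define E' where "E' = (\<lambda>x. if x \<in> box u v then E x else 0)"
      have sp: "E' x = E x" if "x \<in> K - (cbox u v - box u v)" for x
        using that by (auto simp: E'_def K)
      have "integral K E = integral K E'"
        by (rule integral_spike[OF negligible_frontier_interval sp])
      also have "\<dots> \<le> integral K (\<lambda>_. w)"
      proof (rule integral_le)
        show "E' integrable_on K"
          by (rule integrable_spike[OF iEK negligible_frontier_interval sp])
        show "(\<lambda>_. w) integrable_on K" unfolding K by (rule integrable_const)
        show "E' x \<le> w" if "x \<in> K" for x
        proof (cases "x \<in> box u v")
          case True
          then have "x \<in> interior K" by (simp add: K)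
          from ginf[OF this KD(1)] have "Inf (h ` K) \<le> g x" .
          moreover have "h x \<le> Sup (h ` K)" using that bK by (intro cSup_upper) auto
          ultimately show ?thesis using True by (simp add: E'_def E_def w_def)
        next
          case False
          then have "E' x = 0" unfolding E'_def by (rule if_not_P)
          with \<open>w \<ge> 0\<close> show ?thesis by simp
        qed
      qed
      also have "\<dots> = measure lborel K * w" by (simp add: K)
      finally show "integral K E \<le> measure lborel K * (Sup (h ` K) - Inf (h ` K))"
        by (simp add: w_def)
    qed
    finally show "integral {-pi..pi} E \<le> 0 + e" using De by simp
  qed
  moreover have "0 \<le> integral {-pi..pi} E" using iE E0 by (intro integral_nonneg)
  ultimately have I0: "integral {-pi..pi} E = 0" by simp
  have aE: "E absolutely_integrable_on {-pi..pi}"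
    using iE E0 by (intro nonnegative_absolutely_integrable_1)
  have "(LINT x:{-pi..pi}|lebesgue. E x) = 0"
    using set_lebesgue_integral_eq_integral(2)[OF aE] I0 by simp
  then have "AE x in lebesgue. indicat_real {-pi..pi} x *\<^sub>R E x = 0"
    unfolding set_lebesgue_integral_def
    by (subst (asm) integral_nonneg_eq_0_iff_AE)
       (use aE E0 in \<open>auto simp: set_integrable_def indicator_def\<close>)
  then have "AE x \<in> {-pi..pi} in lebesgue. (\<lambda>n. \<phi> n (cis x)) \<longlonglongrightarrow> h x"
  proof eventually_elim
    case (elim x)
    show ?case
    proof
      assume x: "x \<in> {-pi..pi}"
      with elim have "h x = g x" by (simp add: E_def)
      with lim[OF x] show "(\<lambda>n. \<phi> n (cis x)) \<longlonglongrightarrow> h x" by simp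
    qed
  qed
  with cont lower upper show ?thesis by (rule that)
qed

section \<open>Polynomial approximation on the unit circle\<close>

text \<open>A trigonometric polynomial is a Laurent polynomial in \<open>z = cis x\<close>; the
  power \<open>z^N\<close> clears its negative exponents. As this power has modulus 1, it leaves the
  modulus unchanged.\<close>

definition circle_poly :: "(real \<Rightarrow> real) \<Rightarrow> bool" where
  "circle_poly t \<longleftrightarrow> (\<exists>p N. \<forall>x. complex_of_real (t x) * cis x ^ N = poly p (cis x))"

lemma circle_polyI: "(\<And>x. complex_of_real (t x) * cis x ^ N = poly p (cis x)) \<Longrightarrow> circle_poly t"
  unfolding circle_poly_def by blast

lemma circle_poly_const: "circle_poly (\<lambda>x. c)"
  by (rule circle_polyI[of _ 0 "[:of_real c:]"]) simp

lemma circle_poly_add: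
  assumes "circle_poly s" "circle_poly t"
  shows "circle_poly (\<lambda>x. s x + t x)"
proof -
  obtain p N q M where "\<And>x. complex_of_real (s x) * cis x ^ N = poly p (cis x)"
    and "\<And>x. complex_of_real (t x) * cis x ^ M = poly q (cis x)"
    using assms unfolding circle_poly_def by blast
  from this[symmetric] show ?thesis
    by (intro circle_polyI[of _ "N + M" "p * monom 1 M + q * monom 1 N"])
       (simp add: poly_monom power_add algebra_simps)
qed

lemma circle_poly_mult:
  assumes "circle_poly s" "circle_poly t"
  shows "circle_poly (\<lambda>x. s x * t x)"
proof -
  obtain p N q M where "\<And>x. complex_of_real (s x) * cis x ^ N = poly p (cis x)"
    and "\<And>x. complex_of_real (t x) * cis x ^ M = poly q (cis x)"
    using assms unfolding circle_poly_def by blast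
  from this[symmetric] show ?thesis
    by (intro circle_polyI[of _ "N + M" "p * q"]) (simp add: power_add algebra_simps)
qed

lemma circle_poly_sum: "(\<And>i. i \<in> A \<Longrightarrow> circle_poly (t i)) \<Longrightarrow> circle_poly (\<lambda>x. \<Sum>i\<in>A. t i x)"
  by (induction A rule: infinite_finite_induct) (auto intro: circle_poly_const circle_poly_add)

lemma circle_poly_cos: "circle_poly (\<lambda>x. cos (real k * x))"
proof (rule circle_polyI[of _ k "smult (1/2) (monom 1 (2 * k) + 1)"])
  fix x
  have "complex_of_real (cos (real k * x)) = (cis (real k * x) + cis (- (real k * x))) / 2"
    by (simp add: complex_eq_iff)
  then show "complex_of_real (cos (real k * x)) * cis x ^ k = poly (smult (1/2) (monom 1 (2 * k) + 1)) (cis x)"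
    by (simp only:) (simp add: poly_monom Complex.DeMoivre cis_mult algebra_simps)
qed

lemma circle_poly_sin: "circle_poly (\<lambda>x. sin (real k * x))"
proof (rule circle_polyI[of _ k "smult (- \<i> / 2) (monom 1 (2 * k) - 1)"])
  fix x
  have "complex_of_real (sin (real k * x)) = - \<i> / 2 * (cis (real k * x) - cis (- (real k * x)))"
    by (simp add: complex_eq_iff)
  then show "complex_of_real (sin (real k * x)) * cis x ^ k = poly (smult (- \<i> / 2) (monom 1 (2 * k) - 1)) (cis x)"
    by (simp only:) (simp add: poly_monom Complex.DeMoivre cis_mult algebra_simps)
qed

lemma circle_poly_imp_cmod_poly:
  assumes "circle_poly t"
  obtains p where "\<And>x. \<bar>t x\<bar> = cmod (poly p (cis x))"
proof -
  obtain p N where p: "\<And>x. complex_of_real (t x) * cis x ^ N = poly p (cis x)"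
    using assms unfolding circle_poly_def by blast
  have "\<bar>t x\<bar> = cmod (poly p (cis x))" for x
    unfolding p[symmetric] by (simp add: norm_mult norm_power)
  then show ?thesis by (rule that)
qed

lemma trig_poly_imp_circle_poly: "trig_poly t \<Longrightarrow> circle_poly t"
  unfolding trig_poly_def
proof (elim exE)
  fix N :: nat and a b :: "nat \<Rightarrow> real"
  assume *: "\<forall>x. t x = a 0 + (\<Sum>k = 1..N. a k * cos (real k * x) + b k * sin (real k * x))"
  have "circle_poly (\<lambda>x. a 0 + (\<Sum>k = 1..N. a k * cos (real k * x) + b k * sin (real k * x)))"
    by (intro circle_poly_add circle_poly_sum circle_poly_mult circle_poly_const circle_poly_cos circle_poly_sin)
  with * show ?thesis by presburger
qed

text \<open>Stone-Weierstrass provides polynomials in the real and imaginary parts of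
  \<open>z\<close>. A real-linear \<open>f\<close> is determined by its values at 1 and i, so on the
  circle it is a combination of \<open>cos x\<close> and \<open>sin x\<close>.\<close>

lemma real_polynomial_function_imp_circle_poly:
  "real_polynomial_function f \<Longrightarrow> circle_poly (\<lambda>x. f (cis x))"
proof (induction rule: real_polynomial_function.induct)
  case (linear f)
  interpret bounded_linear f by fact
  have "f (cis x) = cos (real 1 * x) * f 1 + sin (real 1 * x) * f \<i>" for x
  proof -
    have "cis x = cos x *\<^sub>R 1 + sin x *\<^sub>R \<i>" by (simp add: complex_eq_iff)
    then show ?thesis by (simp only: add scaleR) simp
  qed
  then show ?case
    using circle_poly_add[OF circle_poly_mult[OF circle_poly_cos[of 1] circle_poly_const[of "f 1"]]
        circle_poly_mult[OF circle_poly_sin[of 1] circle_poly_const[of "f \<i>"]]]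
    by simp
qed (auto intro: circle_poly_const circle_poly_add circle_poly_mult)

text \<open>
  A positive trigonometric polynomial \<open>f\<close> close to \<open>sqrt w\<close> equals the modulus of an algebraic
  polynomial on the circle, so the Fejer--Riesz factorization of \<open>f\<^sup>2\<close> is trivial.
\<close>

lemma poly_square_lower_approx:
  assumes w: "continuous_on (sphere 0 1) w" "\<And>z. z \<in> sphere 0 1 \<Longrightarrow> 0 < w z" and "0 < \<epsilon>"
  obtains p :: "complex poly" where "\<And>x. poly p (cis x) \<noteq> 0"
    "\<And>x. (cmod (poly p (cis x)))\<^sup>2 \<le> w (cis x)"
    "\<And>x. ln (w (cis x)) - \<epsilon> \<le> 2 * ln (cmod (poly p (cis x)))"
proof -
  define v where "v = (\<lambda>z. sqrt (w z))"
  \<comment> \<open>The target is \<open>a * v < f < v\<close>: squaring the lower bound loses the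
    factor \<open>a^2 = exp (- \<epsilon>)\<close>, exactly the permitted loss in the
    logarithm.\<close>
  define a where "a = exp (- \<epsilon> / 2)"
  have a: "0 < a" "a < 1" using \<open>0 < \<epsilon>\<close> by (auto simp: a_def)
  have cv: "continuous_on (sphere 0 1) v" unfolding v_def by (intro continuous_intros w)
  have v0: "0 < v z" if "z \<in> sphere 0 1" for z using w(2)[OF that] by (simp add: v_def)
  obtain z0 where z0: "z0 \<in> sphere 0 1" "\<And>z. z \<in> sphere 0 1 \<Longrightarrow> v z0 \<le> v z"
    using continuous_attains_inf[OF _ _ cv] by auto
  \<comment> \<open>The function to approximate is the midpoint of \<open>a * v\<close> and
    \<open>v\<close>. Half their distance is at least \<open>(1 - a) / 2 * v z0\<close>, where
    \<open>v z0\<close> is the minimum.\<close>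
  have "0 < (1 - a) / 2 * v z0" using a v0[OF z0(1)] by simp
  then obtain f where f: "real_polynomial_function f"
    "\<And>z. z \<in> sphere 0 1 \<Longrightarrow> \<bar>(1 + a) / 2 * v z - f z\<bar> < (1 - a) / 2 * v z0"
    using Stone_Weierstrass_real_polynomial_function[of "sphere 0 1" "\<lambda>z. (1 + a) / 2 * v z"]
    by (metis compact_sphere continuous_on_mult_left cv)
  obtain p where p: "\<And>x. \<bar>f (cis x)\<bar> = cmod (poly p (cis x))"
    using circle_poly_imp_cmod_poly[OF real_polynomial_function_imp_circle_poly[OF f(1)]]
    by blast
  have bnd: "a * v (cis x) < f (cis x)" "f (cis x) < v (cis x)" for x
  proof -
    have "(1 - a) / 2 * v z0 \<le> (1 - a) / 2 * v (cis x)"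
      using z0(2)[of "cis x"] a by (intro mult_left_mono) auto
    with f(2)[of "cis x"] show "a * v (cis x) < f (cis x)" "f (cis x) < v (cis x)"
      by (auto simp: abs_less_iff field_simps)
  qed
  have pos: "0 < a * v (cis x)" for x using a v0[of "cis x"] by simp
  have pf: "cmod (poly p (cis x)) = f (cis x)" for x
    using p[of x] bnd[of x] pos[of x] by simp
  show ?thesis
  proof
    fix x
    show "poly p (cis x) \<noteq> 0" using pf[of x] bnd[of x] pos[of x] by auto
    have "(f (cis x))\<^sup>2 \<le> (v (cis x))\<^sup>2"
      using bnd[of x] pos[of x] by (intro power_mono) auto
    then show "(cmod (poly p (cis x)))\<^sup>2 \<le> w (cis x)"
      using w(2)[of "cis x"] by (simp add: pf v_def)
    have "ln (a * v (cis x)) \<le> ln (f (cis x))"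
      using bnd[of x] pos[of x] by (subst ln_le_cancel_iff) auto
    moreover have "ln (a * v (cis x)) = - \<epsilon> / 2 + ln (w (cis x)) / 2"
      using a v0[of "cis x"] w(2)[of "cis x"] by (simp add: ln_mult v_def ln_sqrt) (simp add: a_def)
    ultimately show "ln (w (cis x)) - \<epsilon> \<le> 2 * ln (cmod (poly p (cis x)))"
      by (simp add: pf)
  qed
qed

text \<open>
  The singularity of \<open>H / |q|\<close> at the zeros of \<open>q\<close> is truncated by \<open>max |q| (1 / (n + 1))\<close>.
\<close>

lemma poly_log_lower_approx:
  fixes \<phi> :: "nat \<Rightarrow> complex \<Rightarrow> real"
  assumes \<phi>: "\<And>n. continuous_on (sphere 0 1) (\<phi> n)" "\<And>n z. z \<in> sphere 0 1 \<Longrightarrow> m \<le> \<phi> n z" "0 < m"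
    and le: "\<And>n x. x \<in> {-pi..pi} \<Longrightarrow> \<phi> n (cis x) \<le> H x"
    and lim: "AE x \<in> {-pi..pi} in lebesgue. (\<lambda>n. \<phi> n (cis x)) \<longlonglongrightarrow> H x"
    and H: "(\<lambda>x. ln (H x)) absolutely_integrable_on {-pi..pi}"
    and q: "q \<noteq> 0" and \<epsilon>: "0 < \<epsilon>"
  obtains p where "p \<noteq> 0" "\<And>x. x \<in> {-pi..pi} \<Longrightarrow> (cmod (poly p (cis x)))\<^sup>2 * cmod (poly q (cis x)) \<le> H x"
    "integral {-pi..pi} (\<lambda>x. ln (H x)) - integral {-pi..pi} (\<lambda>x. ln (cmod (poly q (cis x)))) - \<epsilon>
      \<le> 2 * integral {-pi..pi} (\<lambda>x. ln (cmod (poly p (cis x))))"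
proof -
  let ?I = "{-pi..pi}"
  let ?c = "\<lambda>x. cmod (poly q (cis x))"
  define w where "w = (\<lambda>n z. \<phi> n z / max (cmod (poly q z)) (1 / (real n + 1)))"
  have den: "0 < max (cmod (poly q z)) (1 / (real n + 1))" for n z
    by (simp add: less_max_iff_disj)
  have wpos: "0 < w n z" if "z \<in> sphere 0 1" for n z
    using den[of z n] \<phi>(2)[OF that, of n] \<phi>(3) by (simp add: w_def)
  have cw: "continuous_on (sphere 0 1) (w n)" for n
    unfolding w_def using den
    by (intro continuous_intros \<phi>(1)) (auto simp: less_le)
  have \<phi>pos: "0 < \<phi> n (cis x)" for n x using \<phi>(2)[of "cis x" n] \<phi>(3) by simp
  define L where "L = (\<lambda>x. ln (H x) - ln (?c x))"
  \<comment> \<open>Dominating function: \<open>\<phi> n\<close> lies between \<open>m\<close> and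
    \<open>H\<close>, and where the truncation acts, the logarithm of the denominator lies between
    \<open>ln (?c x)\<close> and 0 because \<open>1 / (n + 1)\<close> is at most 1.\<close>
  define b where "b = (\<lambda>x. \<bar>ln m\<bar> + \<bar>ln (H x)\<bar> + \<bar>ln (?c x)\<bar>)"
  have aq: "(\<lambda>x. ln (?c x)) absolutely_integrable_on ?I"
    by (rule absolutely_integrable_ln_cmod_poly[OF q])
  have aL: "L absolutely_integrable_on ?I" unfolding L_def by (intro set_integral_diff H aq)
  have ab: "b absolutely_integrable_on ?I"
    unfolding b_def
    by (intro set_integral_add(1) set_integrable_abs H aq absolutely_integrable_on_const) simp
  have cwc: "continuous_on ?I (\<lambda>x. ln (w n (cis x)))" for n
    using wpos[of _ n] by (intro continuous_intros continuous_on_compose2[OF cw[of n]]) (auto simp: less_le)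
  then have aw: "(\<lambda>x. ln (w n (cis x))) absolutely_integrable_on ?I" for n
    by (rule absolutely_integrable_continuous_real)
  have nz: "AE x \<in> ?I in lebesgue. poly q (cis x) \<noteq> 0"
    by (rule AE_circle_poly_nonzero[OF q])
  have "(\<lambda>n. LINT x:?I|lebesgue. ln (w n (cis x))) \<longlonglongrightarrow> (LINT x:?I|lebesgue. L x)"
    unfolding set_lebesgue_integral_def
  proof (rule integral_dominated_convergence[where w = "\<lambda>x. indicator ?I x *\<^sub>R b x"])
    show "(\<lambda>x. indicat_real ?I x *\<^sub>R L x) \<in> borel_measurable lebesgue"
      using aL unfolding set_integrable_def by (rule borel_measurable_integrable)
    show "(\<lambda>x. indicat_real ?I x *\<^sub>R ln (w n (cis x))) \<in> borel_measurable lebesgue" for n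
      using aw[of n] unfolding set_integrable_def by (rule borel_measurable_integrable)
    show "integrable lebesgue (\<lambda>x. indicat_real ?I x *\<^sub>R b x)"
      using ab unfolding set_integrable_def .
    show "AE x in lebesgue. norm (indicat_real ?I x *\<^sub>R ln (w n (cis x))) \<le> indicat_real ?I x *\<^sub>R b x" for n
      using nz
    proof eventually_elim
      case (elim x)
      show ?case
      proof (cases "x \<in> ?I")
        case True
        with elim have c: "0 < ?c x" by simp
        let ?d = "max (?c x) (1 / (real n + 1))"
        have "ln m \<le> ln (\<phi> n (cis x))" "ln (\<phi> n (cis x)) \<le> ln (H x)"
          using \<phi>(2)[of "cis x" n] \<phi>(3) le[OF True, of n] by (subst ln_le_cancel_iff; simp)+
        then have "\<bar>ln (\<phi> n (cis x))\<bar> \<le> \<bar>ln m\<bar> + \<bar>ln (H x)\<bar>" by linarith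
        moreover have "\<bar>ln ?d\<bar> \<le> \<bar>ln (?c x)\<bar>"
        proof (cases "1 / (real n + 1) \<le> ?c x")
          case False
          then have "ln (?c x) \<le> ln (1 / (real n + 1))" using c by (subst ln_le_cancel_iff) auto
          moreover have "ln (1 / (real n + 1)) \<le> 0" by (simp add: ln_div)
          ultimately show ?thesis using False by (simp add: max_def)
        qed (simp add: max_def)
        moreover have "ln (w n (cis x)) = ln (\<phi> n (cis x)) - ln ?d"
          using \<phi>pos[of n x] den[of "cis x" n] by (simp add: w_def ln_div)
        ultimately have "\<bar>ln (w n (cis x))\<bar> \<le> b x" unfolding b_def by linarith
        then show ?thesis using True by simp
      qed simp
    qed
    show "AE x in lebesgue. (\<lambda>n. indicat_real ?I x *\<^sub>R ln (w n (cis x))) \<longlonglongrightarrow> indicat_real ?I x *\<^sub>R L x"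
      using nz lim
    proof eventually_elim
      case (elim x)
      show ?case
      proof (cases "x \<in> ?I")
        case True
        with elim have c: "0 < ?c x" and l: "(\<lambda>n. \<phi> n (cis x)) \<longlonglongrightarrow> H x" by auto
        have "0 < H x" using \<phi>pos[of 0 x] le[OF True, of 0] by simp
        have "(\<lambda>n. 1 / (real n + 1)) \<longlonglongrightarrow> 0" by real_asymp
        then have "(\<lambda>n. max (?c x) (1 / (real n + 1))) \<longlonglongrightarrow> max (?c x) 0"
          by (intro tendsto_max tendsto_const)
        then have "(\<lambda>n. ln (w n (cis x))) \<longlonglongrightarrow> ln (H x / max (?c x) 0)"
          unfolding w_def using c \<open>0 < H x\<close> l by (intro tendsto_ln tendsto_divide) auto
        moreover have "ln (H x / max (?c x) 0) = L x"
          using c \<open>0 < H x\<close> by (simp add: L_def ln_div)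
        ultimately show ?thesis using True by simp
      qed simp
    qed
  qed
  then have lim_int: "(\<lambda>n. integral ?I (\<lambda>x. ln (w n (cis x)))) \<longlonglongrightarrow> integral ?I L"
    using set_lebesgue_integral_eq_integral(2)[OF aw] set_lebesgue_integral_eq_integral(2)[OF aL] by simp
  have iL: "integral ?I L = integral ?I (\<lambda>x. ln (H x)) - integral ?I (\<lambda>x. ln (?c x))"
    unfolding L_def using H aq by (intro integral_diff set_lebesgue_integral_eq_integral(1))
  \<comment> \<open>Half of \<epsilon> pays for replacing \<open>L\<close> by
    \<open>ln (w n (cis x))\<close>, the other half for the polynomial: an error of
    \<open>\<epsilon> / (4 * pi)\<close> over an interval of length \<open>2 * pi\<close>.\<close>
  have "integral ?I L - \<epsilon> / 2 < integral ?I L" using \<epsilon> by simp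
  with lim_int obtain n where n: "integral ?I L - \<epsilon> / 2 < integral ?I (\<lambda>x. ln (w n (cis x)))"
    using order_tendstoD(1) eventually_happens' sequentially_bot by blast
  obtain p where p: "\<And>x. poly p (cis x) \<noteq> 0" "\<And>x. (cmod (poly p (cis x)))\<^sup>2 \<le> w n (cis x)"
    "\<And>x. ln (w n (cis x)) - \<epsilon> / (4 * pi) \<le> 2 * ln (cmod (poly p (cis x)))"
    using poly_square_lower_approx[OF cw[of n] wpos, of "\<epsilon> / (4 * pi)"] \<epsilon> by auto
  have p0: "p \<noteq> 0" using p(1) by auto
  show ?thesis
  proof (rule that[OF p0])
    show "(cmod (poly p (cis x)))\<^sup>2 * ?c x \<le> H x" if x: "x \<in> ?I" for x
    proof -
      have "(cmod (poly p (cis x)))\<^sup>2 * ?c x \<le> w n (cis x) * max (?c x) (1 / (real n + 1))"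
        using p(2)[of x] wpos[of "cis x" n] by (intro mult_mono) auto
      also have "\<dots> = \<phi> n (cis x)" using den[of "cis x" n] by (simp add: w_def)
      also have "\<dots> \<le> H x" by (rule le[OF x])
      finally show ?thesis .
    qed
    have ip: "(\<lambda>x. ln (cmod (poly p (cis x)))) integrable_on ?I"
      using set_lebesgue_integral_eq_integral(1)[OF absolutely_integrable_ln_cmod_poly[OF p0]] .
    have iw: "(\<lambda>x. ln (w n (cis x))) integrable_on ?I"
      using set_lebesgue_integral_eq_integral(1)[OF aw] .
    have "integral ?I (\<lambda>x. ln (w n (cis x))) - \<epsilon> / 2 = integral ?I (\<lambda>x. ln (w n (cis x)) - \<epsilon> / (4 * pi))"
      using iw by (subst integral_diff) (auto simp: field_simps)
    also have "\<dots> \<le> integral ?I (\<lambda>x. 2 * ln (cmod (poly p (cis x))))"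
      using iw ip p(3) by (intro integral_le) (auto intro!: integrable_diff)
    also have "\<dots> = 2 * integral ?I (\<lambda>x. ln (cmod (poly p (cis x))))" by simp
    finally show "integral ?I (\<lambda>x. ln (H x)) - integral ?I (\<lambda>x. ln (?c x)) - \<epsilon>
        \<le> 2 * integral ?I (\<lambda>x. ln (cmod (poly p (cis x))))"
      using n iL by simp
  qed
qed

section \<open>Ratio of prediction errors\<close>

lemma shifted_ratio_tendsto_1:
  fixes a :: "nat \<Rightarrow> real"
  assumes a: "\<And>n. 0 < a n" and lim: "(\<lambda>n. a (Suc n) / a n) \<longlonglongrightarrow> 1"
  shows "(\<lambda>n. a (n + d) / a n) \<longlonglongrightarrow> 1"
proof (induction d)
  case 0
  have "a n \<noteq> 0" for n using a[of n] by simp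
  then show ?case by simp
next
  case (Suc d)
  have "(\<lambda>n. a (Suc (n + d)) / a (n + d)) \<longlonglongrightarrow> 1"
    using LIMSEQ_ignore_initial_segment[OF lim] .
  from tendsto_mult[OF this Suc]
  have "(\<lambda>n. a (Suc (n + d)) / a (n + d) * (a (n + d) / a n)) \<longlonglongrightarrow> 1" by simp
  moreover have "(\<lambda>n. a (Suc (n + d)) / a (n + d) * (a (n + d) / a n)) = (\<lambda>n. a (n + Suc d) / a n)"
    using a by (simp add: less_imp_neq[THEN not_sym])
  ultimately show ?case by (simp only:)
qed

text \<open>The shift \<open>d\<close> may depend on \<open>c\<close>, but for fixed
  \<open>c\<close> it changes \<open>a\<close> only by a factor tending to 1. The strict gap between
  \<open>c\<close> and the bound \<open>y\<close> absorbs this factor.\<close>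

lemma ratio_tendstoI:
  fixes a b :: "nat \<Rightarrow> real"
  assumes a: "\<And>n. 0 < a n" and lim: "(\<lambda>n. a (Suc n) / a n) \<longlonglongrightarrow> 1" and G: "0 < G"
    and lower: "\<And>c. 0 < c \<Longrightarrow> c < G \<Longrightarrow> \<exists>d. \<forall>n. c * a (n + d) \<le> b n"
    and upper: "\<And>c. G < c \<Longrightarrow> \<exists>d. \<forall>n. b (n + d) \<le> c * a n"
  shows "(\<lambda>n. b n / a n) \<longlonglongrightarrow> G"
proof (rule order_tendstoI)
  fix y assume "y < G"
  with G obtain c where c: "max 0 y < c" "c < G" using dense[of "max 0 y" G] by auto
  then obtain d where d: "\<And>n. c * a (n + d) \<le> b n" using lower[of c] by auto
  have "(\<lambda>n. c * (a (n + d) / a n)) \<longlonglongrightarrow> c * 1"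
    by (intro tendsto_mult_left shifted_ratio_tendsto_1 a lim)
  then have "eventually (\<lambda>n. y < c * (a (n + d) / a n)) sequentially"
    using c by (intro order_tendstoD(1)[where y = "c * 1"]) auto
  then show "eventually (\<lambda>n. y < b n / a n) sequentially"
  proof eventually_elim
    case (elim n)
    also have "c * (a (n + d) / a n) \<le> b n / a n"
      using divide_right_mono[OF d[of n], of "a n"] a[of n] by simp
    finally show ?case .
  qed
next
  fix y assume "G < y"
  then obtain c where c: "G < c" "c < y" using dense by blast
  then obtain d where d: "\<And>n. b (n + d) \<le> c * a n" using upper[of c] by auto
  have "(\<lambda>n. c * inverse (a (n + d) / a n)) \<longlonglongrightarrow> c * inverse 1"
    by (intro tendsto_mult_left tendsto_inverse shifted_ratio_tendsto_1 a lim) simp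
  then have "eventually (\<lambda>n. c * inverse (a (n + d) / a n) < y) sequentially"
    using c by (intro order_tendstoD(2)[where y = "c * inverse 1"]) auto
  then have "eventually (\<lambda>n. b (n + d) / a (n + d) < y) sequentially"
  proof eventually_elim
    case (elim n)
    have "b (n + d) / a (n + d) \<le> c * inverse (a (n + d) / a n)"
      using divide_right_mono[OF d[of n], of "a (n + d)"] a[of "n + d"] by simp
    with elim show ?case by linarith
  qed
  then show "eventually (\<lambda>n. b n / a n < y) sequentially"
    by (rule eventually_sequentially_seg[of "\<lambda>n. b n / a n < y" d, THEN iffD1])
qed

text \<open>The negative part in \<open>log_integral\<close> is at most the integral of the absolute
  value of \<open>ln g\<close>. Positivity almost everywhere makes \<open>ext_ln\<close> agree with
  \<open>ln\<close>; zeros of \<open>g\<close> would go unnoticed by \<open>ln\<close>, as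
  \<open>ln 0 = 0\<close>.\<close>

lemma nondeterministicI:
  assumes pos: "AE x \<in> {-pi..pi} in lebesgue. 0 < g x"
    and int: "set_integrable lebesgue {-pi..pi} (\<lambda>x. ln (g x))"
  shows "nondeterministic g"
proof -
  let ?B = "\<integral>\<^sup>+x\<in>{-pi..pi}. e2ennreal (- ext_ln (g x)) \<partial>lebesgue"
  have "?B \<le> (\<integral>\<^sup>+x. ennreal (norm (indicat_real {-pi..pi} x *\<^sub>R ln (g x))) \<partial>lebesgue)"
  proof (rule nn_integral_mono_AE)
    show "AE x in lebesgue. e2ennreal (- ext_ln (g x)) * indicator {-pi..pi} x
        \<le> ennreal (norm (indicat_real {-pi..pi} x *\<^sub>R ln (g x)))"
      using pos
    proof eventually_elim
      case (elim x)
      then show ?case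
        by (cases "x \<in> {-pi..pi}") (auto simp: ext_ln_def ennreal.abs_eq[symmetric] intro!: ennreal_leI)
    qed
  qed
  also have "\<dots> < \<infinity>"
    using int unfolding set_integrable_def integrable_iff_bounded by blast
  finally have "enn2ereal ?B < \<infinity>"
    by (simp add: less_ennreal.rep_eq)
  moreover have "0 \<le> enn2ereal ?B" by simp
  moreover have "0 \<le> enn2ereal (\<integral>\<^sup>+x\<in>{-pi..pi}. e2ennreal (ext_ln (g x)) \<partial>lebesgue)" by simp
  ultimately show ?thesis
    unfolding nondeterministic_def log_integral_def
    by (cases "enn2ereal ?B"; cases "enn2ereal (\<integral>\<^sup>+x\<in>{-pi..pi}. e2ennreal (ext_ln (g x)) \<partial>lebesgue)") auto
qed

lemma sphere_cis:
  assumes "z \<in> sphere 0 1"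
  obtains x where "x \<in> {-pi..pi}" "z = cis x"
proof
  show "Arg z \<in> {-pi..pi}" using Arg_bounded[of z] by auto
  show "z = cis (Arg z)" using assms cis_Arg[of z] by (force simp: sgn_eq)
qed

text \<open>Applied twice, to the pairs \<open>f\<close>, \<open>fg\<close> and \<open>fg\<close>,
  \<open>f\<close>. The multiplier is \<open>P * p\<close>, where the squared modulus of
  \<open>p\<close> is just below H / |P Q|, so that of \<open>P * p\<close> is just below H |P| /
  |Q|. The last hypothesis puts \<open>c\<close> strictly below the geometric mean of this bound,
  and the gap is the error allowed in choosing \<open>p\<close>.\<close>

lemma pred_err_sq_shift_ge:
  fixes \<phi> :: "nat \<Rightarrow> complex \<Rightarrow> real"
  assumes \<phi>: "\<And>n. continuous_on (sphere 0 1) (\<phi> n)" "\<And>n z. z \<in> sphere 0 1 \<Longrightarrow> m \<le> \<phi> n z" "0 < m"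
    and le: "\<And>n x. x \<in> {-pi..pi} \<Longrightarrow> \<phi> n (cis x) \<le> H x"
    and lim: "AE x \<in> {-pi..pi} in lebesgue. (\<lambda>n. \<phi> n (cis x)) \<longlonglongrightarrow> H x"
    and H: "(\<lambda>x. ln (H x)) absolutely_integrable_on {-pi..pi}"
    and P: "P \<noteq> 0" and Q: "Q \<noteq> 0"
    and F: "set_integrable lebesgue {-pi..pi} F" "\<And>x. x \<in> {-pi..pi} \<Longrightarrow> 0 \<le> F x"
    and F': "set_integrable lebesgue {-pi..pi} F'"
    and FF': "AE x \<in> {-pi..pi} in lebesgue.
        H x * (cmod (poly P (cis x)) / cmod (poly Q (cis x))) * F x \<le> F' x"
    and c: "0 < c" "2 * pi * ln c < integral {-pi..pi} (\<lambda>x. ln (H x))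
        + integral {-pi..pi} (\<lambda>x. ln (cmod (poly P (cis x)))) - integral {-pi..pi} (\<lambda>x. ln (cmod (poly Q (cis x))))"
  shows "\<exists>d. \<forall>n. c * pred_err_sq (n + d) F \<le> pred_err_sq n F'"
proof -
  let ?I = "{-pi..pi}"
  let ?L = "\<lambda>p. integral ?I (\<lambda>x. ln (cmod (poly p (cis x))))"
  define \<epsilon> where "\<epsilon> = integral ?I (\<lambda>x. ln (H x)) + ?L P - ?L Q - 2 * pi * ln c"
  have "0 < \<epsilon>" using c by (simp add: \<epsilon>_def)
  have "P * Q \<noteq> 0" using P Q by simp
  from poly_log_lower_approx[OF \<phi> le lim H this \<open>0 < \<epsilon>\<close>] obtain p where p: "p \<noteq> 0"
    "\<And>x. x \<in> ?I \<Longrightarrow> (cmod (poly p (cis x)))\<^sup>2 * cmod (poly (P * Q) (cis x)) \<le> H x"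
    "integral ?I (\<lambda>x. ln (H x)) - ?L (P * Q) - \<epsilon> \<le> 2 * ?L p"
    by blast
  have r: "P * p \<noteq> 0" using P p by simp
  have "2 * pi * ln c \<le> 2 * ?L (P * p)"
    using p(3) unfolding integral_ln_cmod_poly_mult[OF P p(1)] integral_ln_cmod_poly_mult[OF P Q] \<epsilon>_def
    by (simp add: algebra_simps)
  then have "ln c \<le> ?L (P * p) / pi" by (simp add: field_simps)
  then have c_le: "c \<le> exp (?L (P * p) / pi)" using c(1) by (metis exp_le_cancel_iff exp_ln)
  have ae: "AE x \<in> ?I in lebesgue. (cmod (poly (P * p) (cis x)))\<^sup>2 * F x \<le> F' x"
    using AE_circle_poly_nonzero[OF Q] FF'
  proof eventually_elim
    case (elim x)
    show ?case
    proof
      assume x: "x \<in> ?I"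
      let ?P = "cmod (poly P (cis x))" and ?Q = "cmod (poly Q (cis x))" and ?p = "cmod (poly p (cis x))"
      have Q0: "0 < ?Q" using elim x by simp
      have "?p\<^sup>2 * (?P * ?Q) * (?P / ?Q) \<le> H x * (?P / ?Q)"
        using p(2)[OF x] by (intro mult_right_mono) (auto simp: norm_mult)
      also have "?p\<^sup>2 * (?P * ?Q) * (?P / ?Q) = (cmod (poly (P * p) (cis x)))\<^sup>2"
        using Q0 by (simp add: norm_mult power2_eq_square)
      finally have "(cmod (poly (P * p) (cis x)))\<^sup>2 * F x \<le> H x * (?P / ?Q) * F x"
        using F(2)[OF x] by (rule mult_right_mono)
      with elim x show "(cmod (poly (P * p) (cis x)))\<^sup>2 * F x \<le> F' x" by auto
    qed
  qed
  have "c * pred_err_sq (n + degree (P * p)) F \<le> pred_err_sq n F'" for n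
    using mult_right_mono[OF c_le pred_err_sq_nonneg[OF F(2)]] pred_err_sq_ge_mult[OF r F F' ae]
    by (rule order_trans)
  then show ?thesis by blast
qed

theorem theorem4p1:
  fixes f g fg h t1 t2 :: "real \<Rightarrow> real"
  assumes "spectral_density f" and "deterministic f"
    and "weakly_varying (\<lambda>n. pred_err n f)"
    and "h \<in> class_B_bdd"
    and "trig_poly t1" and "\<forall>x. 0 \<le> t1 x" and "\<exists>x. t1 x \<noteq> 0"
    and "trig_poly t2" and "\<forall>x. 0 \<le> t2 x" and "\<exists>x. t2 x \<noteq> 0"
    and "\<forall>x\<in>{-pi..pi}. t2 x \<noteq> 0 \<longrightarrow> g x = h x * (t1 x / t2 x)"
    and "\<forall>x\<in>{-pi..pi}. t2 x \<noteq> 0 \<longrightarrow> fg x = f x * g x"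
    \<comment> \<open>at the zeros of \<open>t2\<close>, \<open>g\<close> and \<open>fg\<close> have arbitrary nonnegative values;
        \<open>0 \<le> fg x\<close> there is part of \<open>fg \<in> class_B\<close>\<close>
    and "\<forall>x\<in>{-pi..pi}. t2 x = 0 \<longrightarrow> 0 \<le> g x"
    and "fg \<in> class_B"
    \<comment> \<open>\<open>g\<close> itself need not be integrable, e.g. for \<open>h = t1 = 1\<close>,
        \<open>t2 x = 1 - cos x\<close> and \<open>f x = exp (- 1 / x\<^sup>2)\<close>\<close>
  shows "(\<forall>x\<in>{-pi..pi}. 0 \<le> g x)
    \<and> g \<in> borel_measurable (lebesgue_on {-pi..pi})
    \<and> (set_integrable lebesgue {-pi..pi} g \<longrightarrow> spectral_density g)
    \<and> nondeterministic g
    \<and> (\<lambda>n. pred_err_sq n fg / pred_err_sq n f) \<longlonglongrightarrow> geom_mean g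
    \<and> geom_mean g > 0"
proof -
  let ?I = "{-pi..pi}"
  note g_eq = assms(11)[rule_format] and fg_eq = assms(12)[rule_format]
  have f0: "\<And>x. x \<in> ?I \<Longrightarrow> 0 \<le> f x" and fint: "set_integrable lebesgue ?I f"
    using assms(1) by (auto simp: spectral_density_def)
  have fg0: "\<And>x. x \<in> ?I \<Longrightarrow> 0 \<le> fg x" and fgR: "riemann_integrable_on fg (-pi) pi"
    using assms(14) by (auto simp: class_B_def)
  have fgint: "set_integrable lebesgue ?I fg"
    by (rule nonnegative_absolutely_integrable_1[OF riemann_integrable_imp_integrable_on[OF fgR] fg0])
  obtain m M where m: "0 < m" and mM: "\<And>x. x \<in> ?I \<Longrightarrow> m \<le> h x \<and> h x \<le> M"
    and hR: "riemann_integrable_on h (-pi) pi"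
    using assms(4) unfolding class_B_bdd_def class_B_def by blast
  have hpos: "0 < h x" if "x \<in> ?I" for x using mM[OF that] m by linarith
  have M: "0 < M" using mM[of 0] m by simp
  obtain P1 where "\<And>x. \<bar>t1 x\<bar> = cmod (poly P1 (cis x))"
    using circle_poly_imp_cmod_poly[OF trig_poly_imp_circle_poly[OF assms(5)]] by blast
  then have t1: "t1 x = cmod (poly P1 (cis x))" for x using assms(6) by (metis abs_of_nonneg)
  obtain P2 where "\<And>x. \<bar>t2 x\<bar> = cmod (poly P2 (cis x))"
    using circle_poly_imp_cmod_poly[OF trig_poly_imp_circle_poly[OF assms(8)]] by blast
  then have t2: "t2 x = cmod (poly P2 (cis x))" for x using assms(9) by (metis abs_of_nonneg)
  have P1: "P1 \<noteq> 0" and P2: "P2 \<noteq> 0" using assms(7,10) t1 t2 by auto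
  then have q0: "P1 * P2 \<noteq> 0" by simp
  have q: "cmod (poly (P1 * P2) (cis x)) = t1 x * t2 x" for x by (simp add: t1 t2 norm_mult)
  have nz: "AE x \<in> ?I in lebesgue. 0 < t1 x \<and> 0 < t2 x"
    using AE_circle_poly_nonzero[OF P1] AE_circle_poly_nonzero[OF P2]
    by eventually_elim (auto simp: t1 t2)

  \<comment> \<open>Logarithmic integrals of the factors of \<open>g\<close>\<close>
  have [measurable]: "h \<in> borel_measurable (lebesgue_on ?I)"
    using riemann_integrable_imp_integrable_on[OF hR] by (rule integrable_imp_measurable)
  have alnh: "(\<lambda>x. ln (h x)) absolutely_integrable_on ?I"
  proof (rule measurable_bounded_by_integrable_imp_absolutely_integrable)
    show "(\<lambda>x. ln (h x)) \<in> borel_measurable (lebesgue_on ?I)" by measurable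
    show "(\<lambda>x. \<bar>ln m\<bar> + \<bar>ln M\<bar>) integrable_on ?I" by (rule integrable_const_ivl)
    show "norm (ln (h x)) \<le> \<bar>ln m\<bar> + \<bar>ln M\<bar>" if "x \<in> ?I" for x
    proof -
      have "ln m \<le> ln (h x)" "ln (h x) \<le> ln M"
        using mM[OF that] hpos[OF that] m M by (auto simp: ln_le_cancel_iff)
      then show ?thesis by auto
    qed
  qed simp
  note alnP1 = absolutely_integrable_ln_cmod_poly[OF P1] and alnP2 = absolutely_integrable_ln_cmod_poly[OF P2]
  define H where "H = integral ?I (\<lambda>x. ln (h x))"
  define L1 where "L1 = integral ?I (\<lambda>x. ln (cmod (poly P1 (cis x))))"
  define L2 where "L2 = integral ?I (\<lambda>x. ln (cmod (poly P2 (cis x))))"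
  define J where "J = H + L1 - L2"

  \<comment> \<open>Positivity, measurability and geometric mean of \<open>g\<close>\<close>
  have g0: "\<forall>x\<in>?I. 0 \<le> g x"
    using g_eq assms(6,9,13) hpos by (metis divide_nonneg_nonneg less_imp_le mult_nonneg_nonneg)
  have g_pos: "AE x \<in> ?I in lebesgue. 0 < g x"
    using nz by eventually_elim (use hpos g_eq in \<open>force intro!: mult_pos_pos divide_pos_pos\<close>)
  have gmeas: "g \<in> borel_measurable (lebesgue_on ?I)"
  proof -
    have "(\<lambda>x. h x * (t1 x / t2 x)) \<in> borel_measurable (lebesgue_on ?I)"
    proof -
      have [measurable]: "t1 \<in> borel_measurable (lebesgue_on ?I)" "t2 \<in> borel_measurable (lebesgue_on ?I)"
        unfolding t1 t2 by (intro continuous_imp_measurable_on_sets_lebesgue continuous_intros; simp)+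
      show ?thesis by measurable
    qed
    then have "(\<lambda>x. if x \<in> ?I then h x * (t1 x / t2 x) else 0) \<in> borel_measurable lebesgue"
      by (rule borel_measurable_if[THEN iffD2, rotated]) simp
    \<comment> \<open>\<open>g\<close> agrees with the explicit quotient off the zeros of
      \<open>t1\<close> and \<open>t2\<close>; arbitrary values on this null set are harmless since
      the measure is complete.\<close>
    then have "(\<lambda>x. if x \<in> ?I then g x else 0) \<in> borel_measurable lebesgue"
      by (rule borel_measurable_AE) (use nz in eventually_elim, use g_eq in auto)
    then show ?thesis by (rule borel_measurable_if[THEN iffD1, rotated]) simp
  qed
  define N where "N = {x \<in> ?I. poly (P1 * P2) (cis x) = 0}"
  have N: "negligible N" unfolding N_def by (rule negligible_finite[OF finite_cis_roots[OF q0]])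
  have lng: "ln (g x) = ln (h x) + ln (cmod (poly P1 (cis x))) - ln (cmod (poly P2 (cis x)))"
    if "x \<in> ?I - N" for x
  proof -
    have "0 < t1 x" "0 < t2 x" using that by (auto simp: N_def t1 t2)
    then show ?thesis
      using g_eq[of x] hpos[of x] that by (simp add: ln_mult ln_div t1[symmetric] t2[symmetric])
  qed
  have alng: "(\<lambda>x. ln (g x)) absolutely_integrable_on ?I"
    by (rule absolutely_integrable_spike[OF _ N lng]) (intro set_integral_diff(1) set_integral_add(1) alnh alnP1 alnP2)
  have "integral ?I (\<lambda>x. ln (g x)) =
      integral ?I (\<lambda>x. ln (h x) + ln (cmod (poly P1 (cis x))) - ln (cmod (poly P2 (cis x))))"
    by (rule integral_spike[OF N]) (simp add: lng)
  also have "\<dots> = J"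
    unfolding J_def H_def L1_def L2_def
    using alnh[THEN set_lebesgue_integral_eq_integral(1)] alnP1[THEN set_lebesgue_integral_eq_integral(1)]
      alnP2[THEN set_lebesgue_integral_eq_integral(1)]
    by (simp add: integral_diff integral_add integrable_add)
  finally have Gg: "geom_mean g = exp (J / (2 * pi))"
    using g_pos alng by (simp add: geom_mean_def set_lebesgue_integral_eq_integral(2))

  \<comment> \<open>Convergence of the ratio of prediction errors\<close>
  have asq: "(pred_err n f)\<^sup>2 = pred_err_sq n f" for n
    using pred_err_sq_nonneg[OF f0] by (simp add: pred_err_def)
  have a: "0 < pred_err_sq n f" for n
  proof -
    have "pred_err n f \<noteq> 0" using assms(3) by (simp add: weakly_varying_def)
    then show ?thesis unfolding asq[symmetric] by simp
  qed
  have alim: "(\<lambda>n. pred_err_sq (Suc n) f / pred_err_sq n f) \<longlonglongrightarrow> 1"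
  proof -
    have "(\<lambda>n. pred_err (Suc n) f / pred_err n f) \<longlonglongrightarrow> 1"
      using assms(3) by (simp add: weakly_varying_def)
    from tendsto_power[OF this, of 2] show ?thesis by (simp add: power_divide asq)
  qed
  have "(\<lambda>n. pred_err_sq n fg / pred_err_sq n f) \<longlonglongrightarrow> exp (J / (2 * pi))"
  proof (rule ratio_tendstoI[OF a alim])
    \<comment> \<open>Lower bound: multipliers just below \<open>h * t1 / t2\<close> turn
      competitors for \<open>fg\<close> into competitors for \<open>f\<close>.\<close>
    fix c :: real assume c: "0 < c" "c < exp (J / (2 * pi))"
    then have "ln c < J / (2 * pi)" by (metis exp_gt_zero ln_exp ln_less_cancel_iff)
    then have lnc: "2 * pi * ln c < H + L1 - L2" by (simp add: J_def field_simps)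
    obtain \<phi> where \<phi>: "\<And>n. continuous_on UNIV (\<phi> n)" "\<And>n z. m \<le> \<phi> n z"
      "\<And>n x. x \<in> ?I \<Longrightarrow> \<phi> n (cis x) \<le> h x"
      "AE x \<in> ?I in lebesgue. (\<lambda>n. \<phi> n (cis x)) \<longlonglongrightarrow> h x"
      using riemann_integrable_lower_approx[OF hR mM] by blast
    show "\<exists>d. \<forall>n. c * pred_err_sq (n + d) f \<le> pred_err_sq n fg"
    proof (rule pred_err_sq_shift_ge[OF _ \<phi>(2) m \<phi>(3,4) alnh P1 P2 fint f0 fgint _ c(1) lnc[unfolded H_def L1_def L2_def]])
      show "continuous_on (sphere 0 1) (\<phi> n)" for n by (rule continuous_on_subset[OF \<phi>(1)]) simp
      show "AE x \<in> ?I in lebesgue. h x * (cmod (poly P1 (cis x)) / cmod (poly P2 (cis x))) * f x \<le> fg x"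
        using nz by eventually_elim (auto simp: g_eq fg_eq t1[symmetric] t2[symmetric] mult_ac)
    qed
  next
    \<comment> \<open>Upper bound: \<open>f\<close> and \<open>fg\<close> exchange roles,
      \<open>1 / h\<close> replaces \<open>h\<close>, and \<open>P1\<close> and \<open>P2\<close>
      are swapped.\<close>
    fix c assume c: "exp (J / (2 * pi)) < c"
    then have c0: "0 < c" using exp_gt_zero less_trans by blast
    then have "J / (2 * pi) < ln c" using c by (metis exp_gt_zero ln_exp ln_less_cancel_iff)
    then have "J < 2 * pi * ln c" by (simp add: field_simps)
    \<comment> \<open>This holds even if \<open>h x = 0\<close>, as \<open>1 / 0 = 0\<close> and
      \<open>ln 0 = 0\<close>, so it can be unfolded under binders without a side condition.\<close>
    have ln1h: "ln (1 / h x) = - ln (h x)" for x by (cases "h x = 0") (simp_all add: ln_div)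
    from \<open>J < 2 * pi * ln c\<close> have "2 * pi * ln (1 / c) < - H + L2 - L1" using c0 by (simp add: J_def ln_div)
    then have lnc: "2 * pi * ln (1 / c) < integral ?I (\<lambda>x. ln (1 / h x)) + L2 - L1"
      by (simp add: H_def ln1h)
    \<comment> \<open>On the circle \<open>- \<psi> n\<close> lies between \<open>h\<close> and
      \<open>M\<close>, so its reciprocal is continuous, at least \<open>1 / M\<close>, and
      approximates \<open>1 / h\<close> from below.\<close>
    have "riemann_integrable_on (\<lambda>x. - h x) (-pi) pi" by (rule riemann_integrable_on_uminus[OF hR])
    moreover have "- M \<le> - h x \<and> - h x \<le> - m" if "x \<in> ?I" for x using mM[OF that] by simp
    ultimately obtain \<psi> where \<psi>: "\<And>n. continuous_on UNIV (\<psi> n)" "\<And>n z. - M \<le> \<psi> n z"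
      "\<And>n x. x \<in> ?I \<Longrightarrow> \<psi> n (cis x) \<le> - h x"
      "AE x \<in> ?I in lebesgue. (\<lambda>n. \<psi> n (cis x)) \<longlonglongrightarrow> - h x"
      using riemann_integrable_lower_approx[of "\<lambda>x. - h x" "- M" "- m"] by blast
    have \<psi>neg: "\<psi> n (cis x) < 0" if "x \<in> ?I" for n x using \<psi>(3)[OF that, of n] hpos[OF that] by linarith
    have \<psi>neg': "\<psi> n z < 0" if "z \<in> sphere 0 1" for n z using sphere_cis[OF that] \<psi>neg by metis
    have "\<exists>d. \<forall>n. 1 / c * pred_err_sq (n + d) fg \<le> pred_err_sq n f"
    proof (rule pred_err_sq_shift_ge[where \<phi> = "\<lambda>n z. 1 / - \<psi> n z" and H = "\<lambda>x. 1 / h x" and m = "1 / M",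
          OF _ _ _ _ _ _ P2 P1 fgint fg0 fint _ _ lnc[unfolded L1_def L2_def]])
      show "continuous_on (sphere 0 1) (\<lambda>z. 1 / - \<psi> n z)" for n
        using \<psi>neg' by (intro continuous_intros continuous_on_subset[OF \<psi>(1)]) (auto simp: less_le)
      show "1 / M \<le> 1 / - \<psi> n z" if "z \<in> sphere 0 1" for n z
        using \<psi>(2)[of n z] \<psi>neg'[OF that, of n] by (intro frac_le) auto
      show "1 / - \<psi> n (cis x) \<le> 1 / h x" if "x \<in> ?I" for n x
        using \<psi>(3)[OF that, of n] hpos[OF that] by (intro frac_le) auto
      show "AE x \<in> ?I in lebesgue. (\<lambda>n. 1 / - \<psi> n (cis x)) \<longlonglongrightarrow> 1 / h x"
        using \<psi>(4)
      proof eventually_elim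
        case (elim x)
        show ?case
        proof
          assume x: "x \<in> ?I"
          with elim have "(\<lambda>n. 1 / - \<psi> n (cis x)) \<longlonglongrightarrow> 1 / - (- h x)"
            using hpos[OF x] by (intro tendsto_divide tendsto_const tendsto_minus) auto
          then show "(\<lambda>n. 1 / - \<psi> n (cis x)) \<longlonglongrightarrow> 1 / h x" by simp
        qed
      qed
      show "(\<lambda>x. ln (1 / h x)) absolutely_integrable_on ?I"
        unfolding ln1h using alnh by (simp add: set_integrable_def)
      show "AE x \<in> ?I in lebesgue. 1 / h x * (cmod (poly P2 (cis x)) / cmod (poly P1 (cis x))) * fg x \<le> f x"
        using nz
      proof eventually_elim
        case (elim x)
        then show ?case using hpos[of x] by (auto simp: g_eq fg_eq t1[symmetric] t2[symmetric])
      qed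
    qed (use M c0 in auto)
    then show "\<exists>d. \<forall>n. pred_err_sq (n + d) fg \<le> c * pred_err_sq n f"
      using c0 by (simp add: field_simps)
  qed simp
  moreover have "nondeterministic g" by (rule nondeterministicI[OF g_pos alng])
  ultimately show ?thesis
    using g0 gmeas by (simp add: Gg spectral_density_def)
qed

end
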